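(* Let $f\colon S^2\to S^2$ be an expanding Thurston map, let $\mathcal C\subseteq S^2$ be a Jordan curve containing $\operatorname{post} f$ with $f^{n_{\mathcal C}}(\mathcal C)\subseteq\mathcal C$ for some $n_{\mathcal C}\in\mathbb N$, and let $d$ be a visual metric on $S^2$ for $f$. Let $\mathcal K\subseteq S^2$ be a nonempty compact set with $f(\mathcal K)\subseteq\mathcal K$ that is disjoint from $\operatorname{crit} f$. Fix real numbers $r>0$, $\theta>0$, $\alpha\in(0,1]$, and $\tau>0$. Then there exists a periodic orbit $\mathcal O$ of $f$ with $$\sum_{x\in\mathcal O}d(x,\mathcal K)^\alpha\le\tau\cdot\bigl(\Delta_{r,\theta}(\mathcal O)\bigr)^\alpha .$$
   Context: For a periodic orbit $\mathcal O$, its gap is $\Delta(\mathcal O)=\min\{d(x,y):x,y\in\mathcal O,\ x\ne y\}$ with the convention $\min\emptyset=+\infty$, and its $(r,\theta)$-gap is $\Delta_{r,\theta}(\mathcal O)=\min\{r,\ \theta\cdot\Delta(\mathcal O)\}$. $d(x,\mathcal K)=\inf_{a\in\mathcal K}d(x,a)$. $\mathbb N=\{1,2,\dots\}$, $\mathbb N_0=\mathbb N\cup\{0\}$. $S^2$ is an oriented topological $2$-sphere. A continuous map $f\colon S^2\to S^2$ is a branched covering map if near each $x\in S^2$, in suitable orientation-preserving local homeomorphic coordinates sending $x$ and $f(x)$ to $0\in\mathbb C$, it has the form $z\mapsto z^k$ with $k=\deg_f(x)\in\mathbb N$. Put $\operatorname{crit} f=\{x:\deg_f(x)\ge 2\}$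 and $\operatorname{post} f=\{f^n(x): x\in\operatorname{crit} f,\ n\in\mathbb N\}$. A Thurston map is a branched covering map of topological degree $\ge 2$ with $\operatorname{post} f$ finite. For a Jordan curve $\mathcal C\subseteq S^2$ with $\operatorname{post} f\subseteq\mathcal C$ and $n\in\mathbb N_0$: the $n$-tiles are the closures of the connected components of $S^2\setminus f^{-n}(\mathcal C)$; the $n$-edges are the closures of the connected components of $f^{-n}(\mathcal C)\setminus f^{-n}(\operatorname{post} f)$; the $n$-vertices are the points of $f^{-n}(\operatorname{post} f)$; the $n$-cells are the $n$-tiles, the $n$-edges, and the singletons $\{v\}$ with $v$ an $n$-vertex. A Thurston map $f$ is expanding if for some (equivalently, every) metric inducing the topology of $S^2$ and some (equivalently, every) Jordan curve $\mathcal C\supseteq\operatorname{post} f$, the maximal diameter of $n$-tiles tends to $0$ as $n\to+\infty$. A metric $d$ on $S^2$ is a visual metric for an expanding Thurston map $f$ with expansion factor $\Lambda>1$ if for some (equivalently, every) Jordan curve $\mathcal C\supseteq\operatorname{post} f$ there is $C\ge1$ such that for all $n\in\mathbb N_0$: $d(\sigma,\tau)\ge C^{-1}\Lambda^{-n}$ for all disjoint $n$-cells $\sigma,\tau$, and $C^{-1}\Lambda^{-n}\le\operatorname{diam}_d(\tau)\le C\Lambda^{-n}$ for all $n$-edges and $n$-tiles $\tau$. *)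

theory Defs
  imports "HOL-Complex_Analysis.Complex_Analysis" "HOL-Homology.Homology"
begin

section \<open>Oriented topological spheres\<close>

text \<open>
  The sphere is a type \<open>'a\<close> whose topology is homeomorphic to \<open>nsphere 2\<close>. An orientation is
  given by an oriented atlas. A local homeomorphism between planar regions preserves
  orientation iff it maps small positively oriented circles to loops of winding number \<open>1\<close> around
  the image of the centre. Charts are injective on their domain only; their values elsewhere are
  irrelevant.
\<close>

definition sense_preserving :: "complex set \<Rightarrow> (complex \<Rightarrow> complex) \<Rightarrow> bool" where
  "sense_preserving W g \<longleftrightarrow>
     (\<forall>z r. 0 < r \<longrightarrow> cball z r \<subseteq> W \<longrightarrow> winding_number (g \<circ> circlepath z r) (g z) = 1)"

definition planar_chart :: "'a::topological_space set \<Rightarrow> ('a \<Rightarrow> complex) \<Rightarrow> bool" where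
  "planar_chart U \<phi> \<longleftrightarrow> open U \<and> open (\<phi> ` U) \<and> homeomorphism U (\<phi> ` U) \<phi> (inv_into U \<phi>)"

definition orientation_compatible ::
    "'a::topological_space set \<times> ('a \<Rightarrow> complex) \<Rightarrow> 'a set \<times> ('a \<Rightarrow> complex) \<Rightarrow> bool" where
  "orientation_compatible = (\<lambda>(U, \<phi>) (V, \<psi>).
     sense_preserving (\<phi> ` (U \<inter> V)) (\<psi> \<circ> inv_into U \<phi>))"

definition oriented_atlas :: "('a::topological_space set \<times> ('a \<Rightarrow> complex)) set \<Rightarrow> bool" where
  "oriented_atlas A \<longleftrightarrow>
     (\<Union>(U, \<phi>)\<in>A. U) = UNIV \<and>
     (\<forall>(U, \<phi>)\<in>A. planar_chart U \<phi>) \<and>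
     (\<forall>c\<in>A. \<forall>c'\<in>A. orientation_compatible c c')"

definition oriented_sphere :: "('a::topological_space set \<times> ('a \<Rightarrow> complex)) set \<Rightarrow> bool" where
  "oriented_sphere A \<longleftrightarrow>
     (euclidean :: 'a topology) homeomorphic_space nsphere 2 \<and> oriented_atlas A"

definition oriented_chart ::
    "('a::topological_space set \<times> ('a \<Rightarrow> complex)) set \<Rightarrow> 'a set \<Rightarrow> ('a \<Rightarrow> complex) \<Rightarrow> bool" where
  "oriented_chart A U \<phi> \<longleftrightarrow> planar_chart U \<phi> \<and> (\<forall>c\<in>A. orientation_compatible (U, \<phi>) c)"


section \<open>Thurston maps\<close>

definition local_power_form ::
    "('a::topological_space set \<times> ('a \<Rightarrow> complex)) set \<Rightarrow> ('a \<Rightarrow> 'a) \<Rightarrow> 'a \<Rightarrow> nat \<Rightarrow> bool" where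
  "local_power_form A f x k \<longleftrightarrow>
     (\<exists>U V \<phi> \<psi>. oriented_chart A U \<phi> \<and> oriented_chart A V \<psi> \<and>
        x \<in> U \<and> f ` U \<subseteq> V \<and> \<phi> x = 0 \<and> \<psi> (f x) = 0 \<and>
        (\<forall>u\<in>U. \<psi> (f u) = \<phi> u ^ k))"

definition branched_covering_map ::
    "('a::topological_space set \<times> ('a \<Rightarrow> complex)) set \<Rightarrow> ('a \<Rightarrow> 'a) \<Rightarrow> bool" where
  "branched_covering_map A f \<longleftrightarrow>
     continuous_on UNIV f \<and> (\<forall>x. \<exists>k\<ge>1. local_power_form A f x k)"

definition local_degree ::
    "('a::topological_space set \<times> ('a \<Rightarrow> complex)) set \<Rightarrow> ('a \<Rightarrow> 'a) \<Rightarrow> 'a \<Rightarrow> nat" where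
  "local_degree A f x = (THE k. 1 \<le> k \<and> local_power_form A f x k)"

definition crit ::
    "('a::topological_space set \<times> ('a \<Rightarrow> complex)) set \<Rightarrow> ('a \<Rightarrow> 'a) \<Rightarrow> 'a set" where
  "crit A f = {x. 2 \<le> local_degree A f x}"

definition post ::
    "('a::topological_space set \<times> ('a \<Rightarrow> complex)) set \<Rightarrow> ('a \<Rightarrow> 'a) \<Rightarrow> 'a set" where
  "post A f = {(f ^^ n) x | n x. 1 \<le> n \<and> x \<in> crit A f}"

text \<open>
  The topological degree of a continuous self-map of the sphere is the Brouwer degree of its
  conjugate on \<open>nsphere 2\<close>. The same identification is used for domain and codomain, so the value
  depends neither on the choice of identification nor on an orientation.
\<close>

definition topological_degree :: "('a::topological_space \<Rightarrow> 'a) \<Rightarrow> int" where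
  "topological_degree f =
     (let (h, h') = (SOME (h, h'). homeomorphic_maps (euclidean :: 'a topology) (nsphere 2) h h')
      in Brouwer_degree2 2 (h \<circ> f \<circ> h'))"

definition Thurston_map ::
    "('a::topological_space set \<times> ('a \<Rightarrow> complex)) set \<Rightarrow> ('a \<Rightarrow> 'a) \<Rightarrow> bool" where
  "Thurston_map A f \<longleftrightarrow>
     branched_covering_map A f \<and> 2 \<le> topological_degree f \<and> finite (post A f)"


section \<open>Cell decompositions\<close>

definition Jordan_curve :: "'a::topological_space set \<Rightarrow> bool" where
  "Jordan_curve C \<longleftrightarrow> C homeomorphic sphere (0::complex) 1"

definition tiles :: "('a::topological_space \<Rightarrow> 'a) \<Rightarrow> 'a set \<Rightarrow> nat \<Rightarrow> 'a set set" where
  "tiles f C n = closure ` components (UNIV - (f ^^ n) -` C)"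

definition edges ::
    "('a::topological_space set \<times> ('a \<Rightarrow> complex)) set \<Rightarrow> ('a \<Rightarrow> 'a) \<Rightarrow> 'a set \<Rightarrow> nat
      \<Rightarrow> 'a set set" where
  "edges A f C n = closure ` components ((f ^^ n) -` C - (f ^^ n) -` post A f)"

definition vertices ::
    "('a::topological_space set \<times> ('a \<Rightarrow> complex)) set \<Rightarrow> ('a \<Rightarrow> 'a) \<Rightarrow> nat \<Rightarrow> 'a set" where
  "vertices A f n = (f ^^ n) -` post A f"

definition cells ::
    "('a::topological_space set \<times> ('a \<Rightarrow> complex)) set \<Rightarrow> ('a \<Rightarrow> 'a) \<Rightarrow> 'a set \<Rightarrow> nat
      \<Rightarrow> 'a set set" where
  "cells A f C n = tiles f C n \<union> edges A f C n \<union> {{v} | v. v \<in> vertices A f n}"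


section \<open>Expansion and visual metrics\<close>

text \<open>
  The sphere may carry several metrics, so \<open>d\<close> is an explicit function rather than \<open>dist\<close>.
  Diameters and distances of sets are extended reals, hence meaningful for unbounded metrics also.
\<close>

definition diam :: "('a \<Rightarrow> 'a \<Rightarrow> real) \<Rightarrow> 'a set \<Rightarrow> ereal" where
  "diam d S = (SUP (x, y)\<in>S \<times> S. ereal (d x y))"

definition set_distance :: "('a \<Rightarrow> 'a \<Rightarrow> real) \<Rightarrow> 'a set \<Rightarrow> 'a set \<Rightarrow> ereal" where
  "set_distance d S T = (INF (x, y)\<in>S \<times> T. ereal (d x y))"

definition point_distance :: "('a \<Rightarrow> 'a \<Rightarrow> real) \<Rightarrow> 'a \<Rightarrow> 'a set \<Rightarrow> real" where
  "point_distance d x K = (INF a\<in>K. d x a)"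

definition expanding ::
    "('a::topological_space set \<times> ('a \<Rightarrow> complex)) set \<Rightarrow> ('a \<Rightarrow> 'a) \<Rightarrow> bool" where
  "expanding A f \<longleftrightarrow>
     (\<exists>d C. Metric_space UNIV d \<and> Metric_space.mtopology UNIV d = euclidean \<and>
        Jordan_curve C \<and> post A f \<subseteq> C \<and>
        (\<lambda>n. SUP X\<in>tiles f C n. diam d X) \<longlonglongrightarrow> 0)"

text \<open>
  A visual metric is not required to induce the topology of the sphere: this follows
  from the estimates below when \<open>f\<close> is expanding.
\<close>

definition visual_metric ::
    "('a::topological_space set \<times> ('a \<Rightarrow> complex)) set \<Rightarrow> ('a \<Rightarrow> 'a) \<Rightarrow> ('a \<Rightarrow> 'a \<Rightarrow> real)
      \<Rightarrow> real \<Rightarrow> bool" where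
  "visual_metric A f d \<Lambda> \<longleftrightarrow>
     Metric_space UNIV d \<and> 1 < \<Lambda> \<and>
     (\<exists>C. Jordan_curve C \<and> post A f \<subseteq> C \<and>
       (\<exists>L\<ge>1. \<forall>n.
         (\<forall>\<sigma>\<in>cells A f C n. \<forall>\<tau>\<in>cells A f C n.
            \<sigma> \<inter> \<tau> = {} \<longrightarrow> ereal (1 / (L * \<Lambda> ^ n)) \<le> set_distance d \<sigma> \<tau>) \<and>
         (\<forall>\<tau>\<in>edges A f C n \<union> tiles f C n.
            ereal (1 / (L * \<Lambda> ^ n)) \<le> diam d \<tau> \<and> diam d \<tau> \<le> ereal (L / \<Lambda> ^ n))))"


section \<open>Periodic orbits and their gaps\<close>

definition periodic_orbit :: "('a \<Rightarrow> 'a) \<Rightarrow> 'a set \<Rightarrow> bool" where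
  "periodic_orbit f Orb \<longleftrightarrow>
     (\<exists>x n. 1 \<le> n \<and> (f ^^ n) x = x \<and> Orb = {(f ^^ i) x | i. i < n})"

text \<open>
  Orbits are finite, so the infimum is a minimum; in \<open>ereal\<close> the infimum of
  the empty set is \<open>\<infinity>\<close>, as wanted for fixed points.
\<close>

definition gap :: "('a \<Rightarrow> 'a \<Rightarrow> real) \<Rightarrow> 'a set \<Rightarrow> ereal" where
  "gap d Orb = Inf {ereal (d x y) | x y. x \<in> Orb \<and> y \<in> Orb \<and> x \<noteq> y}"

definition rt_gap :: "('a \<Rightarrow> 'a \<Rightarrow> real) \<Rightarrow> real \<Rightarrow> real \<Rightarrow> 'a set \<Rightarrow> real" where
  "rt_gap d r \<theta> Orb = real_of_ereal (min (ereal r) (ereal \<theta> * gap d Orb))"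

end

theory Submission
  imports Defs
begin

text \<open>
  A periodic orbit contained in \<open>K\<close> makes the left-hand side zero, so suppose that \<open>K\<close> contains
  none. The proof then compares two rates: there are periodic orbits whose distance to \<open>K\<close> is
  smaller than any prescribed power of their period, while repairing an orbit with a small gap costs
  only a fixed power of the period.

  All dynamics is extracted from tiles. In a visual metric two points at distance less than about
  \<open>\<Lambda> ^ (-n)\<close> lie in \<open>n\<close>-tiles that meet; pulling a pair of meeting tiles back under \<open>f ^^ k\<close> gives a
  pair of meeting \<open>(n + k)\<close>-tiles. Hence a point near \<open>(f ^^ k) x\<close> has a preimage under \<open>f ^^ k\<close>
  whose orbit approaches that of \<open>x\<close> exponentially fast backwards in time, with a constant that does
  not depend on \<open>k\<close> (\<open>contracting_lift\<close>). Critical points are no obstacle to the existence of such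
  preimages, only to their uniqueness. Iterating the lift yields a closing lemma (\<open>closing\<close>) and its
  version for chains of orbit segments (\<open>periodic_chain_shadowing\<close>). Near \<open>K\<close>, which avoids the
  critical points, \<open>f\<close> is locally injective and lifts are unique, so that points with the same long
  itinerary are exponentially close (\<open>backward_contraction\<close>).

  For the approximation, cut \<open>K\<close> into finitely many small pieces and consider the graph of itineraries
  of length \<open>n\<close>, with an edge when two itineraries follow each other along an orbit in \<open>K\<close>. If this
  graph has no cycle of length up to \<open>2 * p\<close>, then a walk of length \<open>p\<close> is determined by its set of
  vertices, which makes the number of itineraries of length \<open>n * p\<close> smaller at least by a factor
  \<open>p!\<close> than the \<open>p\<close>-th power of the number of itineraries of length \<open>n\<close>. With \<open>p\<close> about
  \<open>exp (\<gamma> * n)\<close> such a loss lowers the exponential growth rate by nearly \<open>\<gamma>\<close>, which cannot happen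
  again and again. So for every \<open>\<gamma> > 0\<close> there are arbitrarily large \<open>n\<close> with a cycle of length at most
  about \<open>2 * exp (\<gamma> * n)\<close> (\<open>short_itinerary_cycle\<close>); a cycle is a periodic chain with jumps of size
  about \<open>\<Lambda> ^ (-n)\<close>, and shadowing it gives a periodic orbit of period at most about
  \<open>2 * n * exp (\<gamma> * n)\<close> at distance about \<open>\<Lambda> ^ (-n)\<close> from \<open>K\<close>
  (\<open>superpolynomial_periodic_approximation\<close>). This counting argument is due to Bressaud and Quas.

  For the repair, let an orbit of period \<open>m\<close> violate the inequality. Then two of its points are close,
  compared with the sum of the distances to \<open>K\<close>, and one of the two arcs between them has length
  at most \<open>m / 2\<close>. Closing up this arc gives a periodic orbit of at most half the period, whose sum
  of distances is larger by at most a constant factor \<open>H\<close>. Halving the period costs a factor \<open>H\<close>, so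
  \<open>m powr log 2 H\<close> times the sum does not increase. Starting from a sufficiently good approximation, the
  process can be repeated forever, which is absurd since periods are positive integers
  (\<open>periodic_orbit_near_invariant_set\<close>).

  The topological part shows that the tiles behave as expected: there are finitely many of them at each
  level by the Jordan curve theorem, they cover the sphere, and \<open>f\<close> maps tiles onto tiles because a
  branched covering map is open and closed. Local injectivity outside \<open>crit f\<close> needs the uniqueness of
  the local degree, which is obtained by counting preimages.
\<close>

section \<open>Counting itineraries\<close>

lemma sorted_wrt_set_unique:
  assumes asym: "\<And>u v. R u v \<Longrightarrow> \<not> R v u"
    and "sorted_wrt R us" and "sorted_wrt R vs" and "set us = set vs"
  shows "us = vs"
  using assms(2-4)
proof (induction us arbitrary: vs)
  case Nil
  then show ?case by simp
next
  case (Cons u us)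
  then obtain v vs' where vs: "vs = v # vs'"
    by (cases vs) auto
  have irrefl: "\<not> R x x" for x
    using asym by blast
  have "u = v"
  proof (rule ccontr)
    assume "u \<noteq> v"
    then have "u \<in> set vs'" "v \<in> set us"
      using Cons.prems(3) vs by (auto simp: set_eq_iff)
    then have "R v u" "R u v"
      using Cons.prems(1,2) vs by auto
    then show False
      using asym by blast
  qed
  moreover have "u \<notin> set us" "v \<notin> set vs'"
    using Cons.prems(1,2) vs irrefl by auto
  ultimately have "set us = set vs'"
    using Cons.prems(3) vs by (auto simp: set_eq_iff)
  then have "us = vs'"
    using Cons.IH Cons.prems(1,2) vs by simp
  then show ?case
    using vs \<open>u = v\<close> by simp
qed

text \<open>
  Without short cycles, reachability in at most \<open>p\<close> steps is an asymmetric relation along which every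
  walk is sorted. Hence a walk has pairwise distinct vertices and is determined by their set, so that
  walks inject into the \<open>p\<close>-element subsets of \<open>V\<close>, of which there are at most
  \<open>card V ^ p / fact p\<close>.
\<close>

lemma card_walks_without_short_cycle:
  assumes "finite V"
    and walk: "\<And>us. us \<in> S \<Longrightarrow> length us = p \<and> set us \<subseteq> V \<and>
      (\<forall>i. Suc i < p \<longrightarrow> (us ! i, us ! Suc i) \<in> E)"
    and acyclic: "\<And>k v. 1 \<le> k \<Longrightarrow> k \<le> 2 * p \<Longrightarrow> (v, v) \<notin> E ^^ k"
  shows "card S * fact p \<le> card V ^ p"
proof -
  define R where "R u v \<longleftrightarrow> (\<exists>k\<ge>1. k \<le> p \<and> (u, v) \<in> E ^^ k)" for u v
  \<comment> \<open>A path from u to v followed by one from v to u is a cycle of length at most 2 * p.\<close>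
  have asym: "\<not> R v u" if "R u v" for u v
  proof
    assume "R v u"
    with that obtain k l where "1 \<le> k" "k \<le> p" "(u, v) \<in> E ^^ k"
      "1 \<le> l" "l \<le> p" "(v, u) \<in> E ^^ l"
      unfolding R_def by blast
    then have "(u, u) \<in> E ^^ (k + l)"
      by (auto simp: relpow_add)
    then show False
      using acyclic[of "k + l" u] \<open>1 \<le> k\<close> \<open>k \<le> p\<close> \<open>l \<le> p\<close> by simp
  qed
  have sorted: "sorted_wrt R us" if "us \<in> S" for us
  proof -
    have step: "(us ! i, us ! (i + k)) \<in> E ^^ k" if "i + k < p" for i k
      using that
    proof (induction k)
      case (Suc k)
      then show ?case
        using walk[OF \<open>us \<in> S\<close>] by auto
    qed simp
    have "R (us ! i) (us ! j)" if "i < j" "j < p" for i j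
    proof -
      have "(us ! i, us ! j) \<in> E ^^ (j - i)"
        using step[of i "j - i"] that by simp
      then show ?thesis
        unfolding R_def using that by (intro exI[of _ "j - i"]) auto
    qed
    then show ?thesis
      using walk[OF \<open>us \<in> S\<close>] by (auto simp: sorted_wrt_iff_nth_less)
  qed
  have "inj_on set S"
    by (intro inj_onI sorted_wrt_set_unique[of R]) (use asym sorted in auto)
  moreover have "card (set us) = p" if "us \<in> S" for us
  proof -
    have "distinct us"
      using sorted[OF that] asym by (induction us) auto
    then show ?thesis
      using walk[OF that] distinct_card by fastforce
  qed
  ultimately have "card S \<le> card {X. X \<subseteq> V \<and> card X = p}"
    using walk \<open>finite V\<close> by (intro card_inj_on_le[of set]) (auto simp: image_subset_iff)
  also have "\<dots> = card V choose p"
    using n_subsets[OF \<open>finite V\<close>] .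
  finally have "card S * fact p \<le> (card V choose p) * fact p"
    by simp
  also have "\<dots> \<le> card V ^ p"
    using binomial_fact_pow by (simp add: mult.commute)
  finally show ?thesis .
qed

text \<open>
  The single term \<open>p ^ p / p!\<close> of the exponential series at \<open>p\<close> is at most \<open>exp p\<close>.
\<close>

lemma ln_fact_ge:
  assumes "1 \<le> (p::nat)"
  shows "real p * (ln p - 1) \<le> ln (fact p :: real)"
proof -
  have "real p ^ p / fact p \<le> exp p"
  proof -
    have "(\<Sum>n\<in>{p}. real p ^ n /\<^sub>R fact n) \<le> suminf (\<lambda>n. real p ^ n /\<^sub>R fact n)"
      by (intro sum_le_suminf summable_exp_generic) auto
    then show ?thesis
      by (simp add: exp_def divide_inverse mult.commute)
  qed
  then have "ln (real p ^ p / fact p) \<le> p"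
    using ln_mono[of "real p ^ p / fact p" "exp p"] assms by simp
  then show ?thesis
    using assms by (simp add: ln_div ln_realpow algebra_simps)
qed

text \<open>
  The inequality \<open>w (n * p) * p! \<le> w n ^ p\<close> with \<open>p\<close> about \<open>exp (\<gamma> * n)\<close> says that the growth
  rate \<open>ln (w n) / n\<close> drops by at least \<open>\<gamma> - 1 / n\<close> on passing from \<open>n\<close> to \<open>n * p\<close>. Growth rates are
  nonnegative, so this cannot be repeated indefinitely.
\<close>

lemma factorial_loss_not_forever:
  fixes w :: "nat \<Rightarrow> nat" and \<gamma> :: real
  assumes pos: "\<And>n. 1 \<le> w n" and "0 < \<gamma>"
  shows "\<exists>n\<ge>N. w n ^ nat \<lceil>exp (\<gamma> * n)\<rceil>
    < w (n * nat \<lceil>exp (\<gamma> * n)\<rceil>) * fact (nat \<lceil>exp (\<gamma> * n)\<rceil>)"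
proof (rule ccontr)
  assume contra: "\<not> ?thesis"
  define p where "p n = nat \<lceil>exp (\<gamma> * real n)\<rceil>" for n
  have *: "w (n * p n) * fact (p n) \<le> w n ^ p n" if "N \<le> n" for n
    using contra that unfolding p_def by (meson not_le)
  define g where "g n = ln (w n) / n" for n
  \<comment> \<open>Beyond N' the error term 1 / n is at most \<gamma> / 2.\<close>
  define N' where "N' = Max {1, N, nat \<lceil>2 / \<gamma>\<rceil>}"
  have N': "1 \<le> N'" "N \<le> N'" "2 / \<gamma> \<le> N'"
  proof -
    show "1 \<le> N'" "N \<le> N'" by (auto simp: N'_def)
    have "nat \<lceil>2 / \<gamma>\<rceil> \<le> N'" unfolding N'_def by (intro Max_ge) auto
    then show "2 / \<gamma> \<le> N'" by linarith
  qed
  have step: "N' \<le> n * p n \<and> g (n * p n) \<le> g n - \<gamma> / 2" if "N' \<le> n" for n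
  proof -
    have "exp (\<gamma> * n) \<le> p n"
      unfolding p_def by linarith
    then have p0: "1 \<le> p n"
      using exp_gt_zero[of "\<gamma> * real n"] by (cases "p n") auto
    have lnp: "\<gamma> * n \<le> ln (p n)"
      using \<open>exp (\<gamma> * n) \<le> p n\<close> p0 by (simp add: ln_ge_iff)
    have n0: "0 < n"
      using that N' by linarith
    have "ln (real (w (n * p n) * fact (p n))) \<le> ln (real (w n ^ p n))"
      using *[of n] that N' pos[of n] pos[of "n * p n"]
      by (subst ln_le_cancel_iff) (auto simp del: of_nat_mult of_nat_power simp: Suc_le_eq intro!: mult_pos_pos of_nat_0_less_iff[THEN iffD2])
    then have "ln (w (n * p n)) + ln (fact (p n)) \<le> p n * ln (w n)"
      using pos[of n] pos[of "n * p n"] by (simp add: ln_mult ln_realpow Suc_le_eq)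
    moreover have "p n * (\<gamma> * n) \<le> p n * ln (p n)"
      using lnp by (intro mult_left_mono) auto
    ultimately have "ln (w (n * p n)) \<le> p n * (ln (w n) - (\<gamma> * n - 1))"
      using ln_fact_ge[OF p0] unfolding right_diff_distrib by linarith
    then have "g (n * p n) \<le> p n * (ln (w n) - (\<gamma> * n - 1)) / (n * p n)"
      unfolding g_def by (intro divide_right_mono) auto
    also have "\<dots> = g n - \<gamma> + 1 / n"
      unfolding g_def using p0 n0 by (simp add: field_simps)
    also have "1 / real n \<le> \<gamma> / 2"
    proof -
      have "2 / \<gamma> \<le> real n"
        using that N'(3) by linarith
      then show ?thesis
        using n0 \<open>0 < \<gamma>\<close> by (simp add: field_simps)
    qed
    finally show ?thesis
      using that p0 by (auto intro: order.trans[of _ n])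
  qed
  have "\<exists>n\<ge>N'. g n \<le> g N' - j * (\<gamma> / 2)" for j :: nat
  proof (induction j)
    case (Suc j)
    then obtain n where "N' \<le> n" "g n \<le> g N' - j * (\<gamma> / 2)" by blast
    then show ?case
      using step[of n] by (intro exI[of _ "n * p n"]) (simp add: algebra_simps add_divide_distrib)
  qed auto
  moreover have "0 \<le> g n" for n
    unfolding g_def using pos[of n] by simp
  ultimately have "real j * (\<gamma> / 2) \<le> g N'" for j :: nat
    by (metis diff_ge_0_iff_ge order.trans)
  moreover obtain j :: nat where "g N' < j * (\<gamma> / 2)"
    using reals_Archimedean3[of "\<gamma> / 2"] \<open>0 < \<gamma>\<close> by (auto simp: mult.commute)
  ultimately show False
    using not_less by blast
qed

definition itinerary :: "('a \<Rightarrow> 'b) \<Rightarrow> ('a \<Rightarrow> 'a) \<Rightarrow> nat \<Rightarrow> 'a \<Rightarrow> 'b list" where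
  "itinerary \<xi> f n x = map (\<lambda>i. \<xi> ((f ^^ i) x)) [0..<n]"

lemma funpow_in_invariant: "f ` K \<subseteq> K \<Longrightarrow> x \<in> K \<Longrightarrow> (f ^^ n) x \<in> K"
  by (induction n) auto

lemma itinerary_eq_iff:
  "itinerary \<xi> f n x = itinerary \<xi> f n y \<longleftrightarrow> (\<forall>i<n. \<xi> ((f ^^ i) x) = \<xi> ((f ^^ i) y))"
  by (auto simp: itinerary_def)

text \<open>
  The vertices of the graph are the itineraries of length \<open>n\<close> of points of \<open>K\<close>; an edge joins two
  itineraries that follow each other along an orbit. An itinerary of length \<open>n * p\<close> is the same as a
  walk of \<open>p\<close> vertices that comes from an orbit, so without short cycles the numbers of
  itineraries would suffer the loss excluded by \<open>factorial_loss_not_forever\<close>.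
\<close>

lemma short_itinerary_cycle:
  fixes f :: "'a \<Rightarrow> 'a" and \<xi> :: "'a \<Rightarrow> 'b" and \<gamma> :: real
  assumes "K \<noteq> {}" and inv: "f ` K \<subseteq> K" and fin: "finite (\<xi> ` K)" and "0 < \<gamma>"
  obtains n k x where "N \<le> n" "1 \<le> k" "real k \<le> 2 * (exp (\<gamma> * n) + 1)"
    "\<And>i. i \<le> k \<Longrightarrow> x i \<in> K" "x k = x 0"
    "\<And>i. i < k \<Longrightarrow> itinerary \<xi> f n ((f ^^ n) (x i)) = itinerary \<xi> f n (x (Suc i))"
proof -
  define it where "it = itinerary \<xi> f"
  have funK: "(f ^^ n) x \<in> K" if "x \<in> K" for x n
    using funpow_in_invariant[OF inv that] .
  have finW: "finite (it n ` K)" for n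
  proof (rule finite_subset)
    show "it n ` K \<subseteq> {xs. set xs \<subseteq> \<xi> ` K \<and> length xs = n}"
      using funK by (auto simp: it_def itinerary_def)
    show "finite {xs. set xs \<subseteq> \<xi> ` K \<and> length xs = n}"
      using finite_lists_length_eq[OF fin] .
  qed
  define w where "w n = card (it n ` K)" for n
  have w: "1 \<le> w n" for n
    using finW[of n] \<open>K \<noteq> {}\<close> by (simp add: w_def Suc_le_eq card_gt_0_iff)
  obtain n where n: "N \<le> n"
    "w n ^ nat \<lceil>exp (\<gamma> * n)\<rceil> < w (n * nat \<lceil>exp (\<gamma> * n)\<rceil>) * fact (nat \<lceil>exp (\<gamma> * n)\<rceil>)"
    using factorial_loss_not_forever[of w \<gamma> N] w \<open>0 < \<gamma>\<close> by metis
  define p where "p = nat \<lceil>exp (\<gamma> * real n)\<rceil>"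
  define E where "E = {(it n x, it n ((f ^^ n) x)) | x. x \<in> K}"
  define walk where "walk x = map (\<lambda>i. it n ((f ^^ (n * i)) x)) [0..<p]" for x
  have "\<exists>k v. 1 \<le> k \<and> k \<le> 2 * p \<and> (v, v) \<in> E ^^ k"
  proof (rule ccontr)
    assume "\<not> ?thesis"
    then have "card (walk ` K) * fact p \<le> card (it n ` K) ^ p"
    proof (intro card_walks_without_short_cycle[where E = E])
      fix us assume "us \<in> walk ` K"
      then obtain x where x: "x \<in> K" "us = walk x" by blast
      have "(us ! i, us ! Suc i) \<in> E" if "Suc i < p" for i
      proof -
        have "(f ^^ (n * Suc i)) x = (f ^^ n) ((f ^^ (n * i)) x)"
          by (simp add: funpow_add)
        then show ?thesis
          unfolding E_def x walk_def using that funK[OF x(1)] by auto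
      qed
      then show "length us = p \<and> set us \<subseteq> it n ` K \<and> (\<forall>i. Suc i < p \<longrightarrow> (us ! i, us ! Suc i) \<in> E)"
        using x funK by (auto simp: walk_def)
    qed (use finW in auto)
    moreover have "w (n * p) \<le> card (walk ` K)"
    proof -
      have determined: "it (n * p) x = it (n * p) y" if "walk x = walk y" for x y
        unfolding it_def itinerary_eq_iff
      proof (intro allI impI)
        fix i assume i: "i < n * p"
        then have "0 < n" by (cases n) auto
        have q: "i div n < p"
          using i by (simp add: less_mult_imp_div_less mult.commute)
        then have "it n ((f ^^ (n * (i div n))) x) = it n ((f ^^ (n * (i div n))) y)"
          using that unfolding walk_def by simp
        then have "\<xi> ((f ^^ (i mod n)) ((f ^^ (n * (i div n))) x))
            = \<xi> ((f ^^ (i mod n)) ((f ^^ (n * (i div n))) y))"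
          using \<open>0 < n\<close> unfolding it_def itinerary_eq_iff by simp
        moreover have "(f ^^ (i mod n)) ((f ^^ (n * (i div n))) z) = (f ^^ i) z" for z
          by (metis comp_apply funpow_add mod_mult_div_eq)
        ultimately show "\<xi> ((f ^^ i) x) = \<xi> ((f ^^ i) y)"
          by simp
      qed
      have "it (n * p) x = it (n * p) (inv_into K walk (walk x))" if "x \<in> K" for x
        by (rule determined) (simp add: that f_inv_into_f)
      then have "it (n * p) ` K \<subseteq> (\<lambda>us. it (n * p) (inv_into K walk us)) ` walk ` K"
        by blast
      moreover have "finite (walk ` K)"
      proof (rule finite_subset)
        show "walk ` K \<subseteq> {us. set us \<subseteq> it n ` K \<and> length us = p}"
          using funK by (auto simp: walk_def)
        show "finite {us. set us \<subseteq> it n ` K \<and> length us = p}"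
          using finite_lists_length_eq[OF finW] .
      qed
      ultimately show ?thesis
        unfolding w_def by (meson card_image_le card_mono finite_imageI le_trans)
    qed
    ultimately have "w (n * p) * fact p \<le> w n ^ p"
      unfolding w_def by (meson le_trans mult_le_mono1)
    then show False
      using n(2) unfolding p_def by simp
  qed
  then obtain k v where kv: "1 \<le> k" "k \<le> 2 * p" "(v, v) \<in> E ^^ k" by blast
  then obtain u where u: "u 0 = v" "u k = v" "\<And>i. i < k \<Longrightarrow> (u i, u (Suc i)) \<in> E"
    by (auto simp: relpow_fun_conv)
  then have "\<forall>i. \<exists>x. i < k \<longrightarrow> x \<in> K \<and> it n x = u i \<and> it n ((f ^^ n) x) = u (Suc i)"
    unfolding E_def by auto metis
  then obtain x where x: "\<And>i. i < k \<Longrightarrow> x i \<in> K \<and> it n (x i) = u i \<and> it n ((f ^^ n) (x i)) = u (Suc i)"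
    by metis
  \<comment> \<open>The cycle ends at its first vertex, so the point representing that vertex serves again at the end.\<close>
  define y where "y = x(k := x 0)"
  have y: "it n (y i) = u i \<and> y i \<in> K" if "i \<le> k" for i
    using that x[of i] x[of 0] u(1,2) kv(1) by (auto simp: y_def)
  show ?thesis
  proof (rule that[of n k y])
    show "real k \<le> 2 * (exp (\<gamma> * real n) + 1)"
    proof -
      have "real p \<le> exp (\<gamma> * real n) + 1"
        using exp_gt_zero[of "\<gamma> * real n"] unfolding p_def by linarith
      moreover have "real k \<le> 2 * real p"
        using kv(2) by linarith
      ultimately show ?thesis
        by (metis mult_left_mono order.trans zero_le_numeral)
    qed
    show "itinerary \<xi> f n ((f ^^ n) (y i)) = itinerary \<xi> f n (y (Suc i))" if "i < k" for i
      using x[OF that] y[of "Suc i"] that by (simp add: y_def it_def)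
    show "y i \<in> K" if "i \<le> k" for i
      using y[OF that] by blast
  qed (use n kv in \<open>auto simp: y_def\<close>)
qed

section \<open>Shadowing in a space with visual tiles\<close>

lemma (in Metric_space) compactin_subsequence:
  assumes "compactin mtopology S" and "\<And>n. x n \<in> S"
  obtains l r where "l \<in> S" "strict_mono (r :: nat \<Rightarrow> nat)" "limitin mtopology (x \<circ> r) l sequentially"
proof -
  have "range x \<subseteq> S" using assms(2) by blast
  then have "\<exists>l r. l \<in> S \<and> strict_mono (r :: nat \<Rightarrow> nat) \<and> limitin mtopology (x \<circ> r) l sequentially"
    using assms(1) unfolding compactin_sequentially by blast
  then show ?thesis using that by blast
qed

text \<open>
  The properties of the tiles of an expanding Thurston map, with respect to a visual metric, on which all
  estimates rest. Since \<open>tile_lift\<close> asserts the existence of a lifted tile through \<open>z\<close> but not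
  its uniqueness, it also holds when \<open>z\<close> is a critical point.
\<close>

locale visual_tiling = Metric_space UNIV d for d :: "'a \<Rightarrow> 'a \<Rightarrow> real" +
  fixes f :: "'a \<Rightarrow> 'a" and T :: "nat \<Rightarrow> 'a set set" and L \<Lambda> :: real
  assumes compact: "compact_space mtopology"
    and cont: "continuous_map mtopology mtopology f"
    and L: "1 \<le> L" and \<Lambda>: "1 < \<Lambda>"
    and tile_cover: "\<exists>X\<in>T n. x \<in> X"
    and tile_image: "X \<in> T (Suc n) \<Longrightarrow> f ` X \<in> T n"
    and tile_lift: "X \<in> T n \<Longrightarrow> f z \<in> X \<Longrightarrow> \<exists>Y\<in>T (Suc n). z \<in> Y \<and> f ` Y = X"
    and tile_separation: "X \<in> T n \<Longrightarrow> Y \<in> T n \<Longrightarrow> X \<inter> Y = {} \<Longrightarrow> x \<in> X \<Longrightarrow> y \<in> Y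
      \<Longrightarrow> 1 / (L * \<Lambda> ^ n) \<le> d x y"
    and tile_diameter: "X \<in> T n \<Longrightarrow> x \<in> X \<Longrightarrow> y \<in> X \<Longrightarrow> d x y \<le> L / \<Lambda> ^ n"
begin

lemma tile_image_iterate: "X \<in> T (n + k) \<Longrightarrow> (f ^^ k) ` X \<in> T n"
proof (induction k arbitrary: X)
  case (Suc k)
  then have "(f ^^ k) ` f ` X \<in> T n"
    using tile_image by simp
  then show ?case
    by (simp add: image_image funpow_swap1)
qed simp

lemma tile_lift_iterate:
  "X \<in> T n \<Longrightarrow> (f ^^ k) z \<in> X \<Longrightarrow> \<exists>Y\<in>T (n + k). z \<in> Y \<and> (f ^^ k) ` Y = X"
proof (induction k arbitrary: z)
  case (Suc k)
  then obtain Y where Y: "Y \<in> T (n + k)" "f z \<in> Y" "(f ^^ k) ` Y = X"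
    by (metis comp_apply funpow_Suc_right)
  from tile_lift[OF Y(1,2)] obtain Z where "Z \<in> T (Suc (n + k))" "z \<in> Z" "f ` Z = Y"
    by blast
  then show ?case
    using Y by (intro bexI[of _ Z]) (auto simp: funpow_Suc_right image_comp simp del: funpow.simps)
next
  case 0
  then show ?case
    by (intro bexI[of _ X]) simp_all
qed

text \<open>
  The constant of \<open>contracting_lift\<close>: \<open>2\<close> for the two tiles to be traversed, one factor \<open>L\<close> for their
  diameter, the other for the separation, and \<open>\<Lambda>\<close> for rounding to an integer level.
\<close>

definition "lift_const = 2 * L\<^sup>2 * \<Lambda>"

lemma lift_const_ge: "2 \<le> lift_const"
proof -
  have "1 \<le> L\<^sup>2" using L by simp
  then have "1 * 1 \<le> L\<^sup>2 * \<Lambda>"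
    using \<Lambda> by (intro mult_mono) auto
  then show ?thesis by (simp add: lift_const_def)
qed

text \<open>
  The level at which tiles have size comparable to the given distance \<open>t\<close>.
\<close>

lemma visual_scale:
  assumes "0 < t" "t < 1 / L"
  obtains n where "t < 1 / (L * \<Lambda> ^ n)" "1 / \<Lambda> ^ n \<le> L * \<Lambda> * t"
proof -
  define n where "n = (LEAST n. 1 / (L * \<Lambda> ^ Suc n) \<le> t)"
  obtain m where "1 / (L * t) < \<Lambda> ^ m"
    using real_arch_pow[OF \<Lambda>] by blast
  also have "\<Lambda> ^ m \<le> \<Lambda> ^ Suc m"
    using \<Lambda> by (intro power_increasing) auto
  finally have "1 / (L * \<Lambda> ^ Suc m) \<le> t"
    using L \<Lambda> assms(1) by (simp add: field_simps)
  then have n: "1 / (L * \<Lambda> ^ Suc n) \<le> t"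
    unfolding n_def by (rule LeastI)
  have "t < 1 / (L * \<Lambda> ^ n)"
  proof (cases n)
    case (Suc k)
    then show ?thesis
      using not_less_Least[of k "\<lambda>n. 1 / (L * \<Lambda> ^ Suc n) \<le> t"] unfolding n_def by simp
  qed (use assms in simp)
  moreover have "1 / \<Lambda> ^ n \<le> L * \<Lambda> * t"
    using n L \<Lambda> by (simp add: field_simps)
  ultimately show ?thesis
    by (rule that)
qed

lemma nearby_tiles_meet:
  assumes "X \<in> T n" "x \<in> X" "Y \<in> T n" "y \<in> Y" "d x y < 1 / (L * \<Lambda> ^ n)"
  shows "X \<inter> Y \<noteq> {}"
proof
  assume "X \<inter> Y = {}"
  from tile_separation[OF assms(1,3) this assms(2,4)] assms(5) show False by linarith
qed

text \<open>
  At the level \<open>n\<close> matching the distance \<open>d ((f ^^ k) x) y\<close>, the image of an \<open>(n + k)\<close>-tile at \<open>x\<close>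
  meets an \<open>n\<close>-tile at \<open>y\<close>. Lifting the latter along a point of the former over the intersection
  gives two \<open>(n + k)\<close>-tiles that meet, and their images under \<open>f ^^ i\<close> are meeting tiles of level
  \<open>n + (k - i)\<close>.
\<close>

proposition contracting_lift:
  assumes "d ((f ^^ k) x) y < 1 / L"
  obtains y' where "(f ^^ k) y' = y"
    "\<And>i. i \<le> k \<Longrightarrow> d ((f ^^ i) x) ((f ^^ i) y') \<le> lift_const * d ((f ^^ k) x) y / \<Lambda> ^ (k - i)"
proof (cases "d ((f ^^ k) x) y = 0")
  case True
  then show ?thesis
    using that[of x] by simp
next
  case False
  define t where "t = d ((f ^^ k) x) y"
  obtain n where n: "t < 1 / (L * \<Lambda> ^ n)" "1 / \<Lambda> ^ n \<le> L * \<Lambda> * t"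
    using visual_scale[of t] assms False unfolding t_def by (metis nonneg less_eq_real_def)
  obtain X where X: "X \<in> T (n + k)" "x \<in> X"
    using tile_cover by blast
  obtain Y where Y: "Y \<in> T n" "y \<in> Y"
    using tile_cover by blast
  have "(f ^^ k) ` X \<inter> Y \<noteq> {}"
    using nearby_tiles_meet[OF tile_image_iterate[OF X(1)] imageI[OF X(2)] Y] n(1)
    by (simp add: t_def)
  then obtain z where z: "z \<in> X" "(f ^^ k) z \<in> Y" by blast
  then obtain Y' where Y': "Y' \<in> T (n + k)" "z \<in> Y'" "(f ^^ k) ` Y' = Y"
    using tile_lift_iterate[OF Y(1)] by blast
  then obtain y' where y': "y' \<in> Y'" "(f ^^ k) y' = y"
    using Y(2) by blast
  show ?thesis
  proof (rule that[OF y'(2)], fold t_def)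
    fix i assume "i \<le> k"
    have tiles: "(f ^^ i) ` X \<in> T (n + (k - i))" "(f ^^ i) ` Y' \<in> T (n + (k - i))"
      using X(1) Y'(1) \<open>i \<le> k\<close> by (auto intro!: tile_image_iterate)
    have "d ((f ^^ i) x) ((f ^^ i) y') \<le> d ((f ^^ i) x) ((f ^^ i) z) + d ((f ^^ i) z) ((f ^^ i) y')"
      by (intro triangle) auto
    also have "\<dots> \<le> L / \<Lambda> ^ (n + (k - i)) + L / \<Lambda> ^ (n + (k - i))"
      using X(2) z(1) Y'(2) y'(1) by (intro add_mono tile_diameter tiles[THEN tile_diameter] imageI)
    also have "\<dots> = 2 * L * (1 / \<Lambda> ^ n) / \<Lambda> ^ (k - i)"
      by (simp add: power_add)
    also have "\<dots> \<le> 2 * L * (L * \<Lambda> * t) / \<Lambda> ^ (k - i)"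
      using n(2) L \<Lambda> by (intro divide_right_mono mult_left_mono) auto
    finally show "d ((f ^^ i) x) ((f ^^ i) y') \<le> lift_const * t / \<Lambda> ^ (k - i)"
      by (simp add: lift_const_def power2_eq_square mult_ac)
  qed
qed

lemma expansion_power_ge_1: "1 \<le> \<Lambda> ^ n"
  by (rule one_le_power[OF less_imp_le[OF \<Lambda>]])

lemma contracted_le:
  assumes "0 \<le> c" shows "c / \<Lambda> ^ n \<le> c"
proof -
  have "c / \<Lambda> ^ n \<le> c / 1"
    using assms expansion_power_ge_1[of n] by (intro divide_left_mono) auto
  then show ?thesis by simp
qed

text \<open>
  The lift of \<open>(f ^^ k) y\<close> along the orbit of \<open>x\<close> is \<open>y\<close> itself, because at each step backwards both
  lie in a ball on which \<open>f\<close> is injective. So \<open>y\<close> inherits the contraction of the lift.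
\<close>

lemma backward_contraction:
  assumes inj: "\<And>i. i < k \<Longrightarrow> inj_on f (mball ((f ^^ i) x) \<rho>)"
    and close: "\<And>i. i \<le> k \<Longrightarrow> d ((f ^^ i) x) ((f ^^ i) y) < \<epsilon>"
    and \<epsilon>: "lift_const * \<epsilon> \<le> \<rho>" "\<epsilon> \<le> 1 / L"
  shows "d x y \<le> lift_const * \<epsilon> / \<Lambda> ^ k"
proof -
  have \<epsilon>0: "0 < \<epsilon>"
    using order.strict_trans1[OF nonneg close[of 0]] by simp
  obtain y' where y': "(f ^^ k) y' = (f ^^ k) y"
    "\<And>i. i \<le> k \<Longrightarrow> d ((f ^^ i) x) ((f ^^ i) y')
      \<le> lift_const * d ((f ^^ k) x) ((f ^^ k) y) / \<Lambda> ^ (k - i)"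
    using contracting_lift[of k x "(f ^^ k) y"] close[of k] \<epsilon>(2) by auto
  have y'_close: "d ((f ^^ i) x) ((f ^^ i) y') < lift_const * \<epsilon>" if "i \<le> k" for i
  proof -
    have "d ((f ^^ i) x) ((f ^^ i) y') \<le> lift_const * d ((f ^^ k) x) ((f ^^ k) y) / \<Lambda> ^ (k - i)"
      using y'(2)[OF that] .
    also have "\<dots> \<le> lift_const * d ((f ^^ k) x) ((f ^^ k) y)"
      using lift_const_ge by (intro contracted_le) simp
    also have "\<dots> < lift_const * \<epsilon>"
      using close[of k] lift_const_ge by simp
    finally show ?thesis .
  qed
  have "(f ^^ (k - j)) y' = (f ^^ (k - j)) y" if "j \<le> k" for j
    using that
  proof (induction j)
    case (Suc j)
    define i where "i = k - Suc j"
    have i: "i < k" "Suc i = k - j"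
      using Suc.prems by (auto simp: i_def)
    have "f ((f ^^ i) y') = f ((f ^^ i) y)"
      using Suc i by (metis Suc_leD comp_apply funpow.simps(2))
    moreover have "(f ^^ i) y' \<in> mball ((f ^^ i) x) \<rho>"
      using y'_close[of i] i \<epsilon>(1) by simp
    moreover have "\<epsilon> \<le> lift_const * \<epsilon>"
      using lift_const_ge \<epsilon>0 by simp
    then have "(f ^^ i) y \<in> mball ((f ^^ i) x) \<rho>"
      using close[of i] i \<epsilon>(1) by simp
    ultimately show ?case
      using inj_onD[OF inj[OF i(1)]] by (simp add: i_def)
  qed (use y'(1) in simp)
  from this[of k] have "y' = y" by simp
  then have "d x y \<le> lift_const * d ((f ^^ k) x) ((f ^^ k) y) / \<Lambda> ^ k"
    using y'(2)[of 0] by simp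
  also have "\<dots> \<le> lift_const * \<epsilon> / \<Lambda> ^ k"
    using close[of k] lift_const_ge \<Lambda> by (intro divide_right_mono mult_left_mono) auto
  finally show ?thesis .
qed

lemma cont_iterate: "continuous_map mtopology mtopology (f ^^ n)"
proof (induction n)
  case (Suc n)
  then show ?case
    unfolding funpow.simps(2) by (rule continuous_map_compose[OF _ cont])
qed (unfold funpow.simps(1), rule continuous_map_id)

lemma limitin_iterate:
  assumes "limitin mtopology u l sequentially"
  shows "limitin mtopology (\<lambda>n. (f ^^ i) (u n)) ((f ^^ i) l) sequentially"
  using continuous_map_limit[OF cont_iterate assms] unfolding o_def .

lemma limitin_nearby:
  assumes "limitin mtopology u l sequentially" and "(\<lambda>n. d (u n) (v n)) \<longlonglongrightarrow> 0"
  shows "limitin mtopology v l sequentially"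
proof -
  have "(\<lambda>n. d (u n) l) \<longlonglongrightarrow> 0"
    using assms(1) by (simp add: limitin_metric_dist_null)
  then have "(\<lambda>n. d (u n) (v n) + d (u n) l) \<longlonglongrightarrow> 0"
    using tendsto_add[OF assms(2)] by fastforce
  then have "(\<lambda>n. d (v n) l) \<longlonglongrightarrow> 0"
  proof (rule Lim_null_comparison[rotated])
    have "d (v n) l \<le> d (u n) (v n) + d (u n) l" for n
      using triangle[of "v n" "u n" l] commute[of "v n" "u n"] by simp
    then show "\<forall>\<^sub>F n in sequentially. norm (d (v n) l) \<le> d (u n) (v n) + d (u n) l"
      by simp
  qed
  then show ?thesis
    by (simp add: limitin_metric_dist_null)
qed

lemma limitin_dist_le:
  assumes "limitin mtopology u l sequentially" and "\<And>n. d x (u n) \<le> c"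
  shows "d x l \<le> c"
proof -
  have lim: "(\<lambda>n. d (u n) l) \<longlonglongrightarrow> 0"
    using assms(1) by (simp add: limitin_metric_dist_null)
  have "d x l - c \<le> d (u n) l" for n
    using triangle[of x "u n" l] assms(2)[of n] by simp
  then have "d x l - c \<le> 0"
    using LIMSEQ_le_const[OF lim] by blast
  then show ?thesis by simp
qed

text \<open>
  Starting from \<open>v 0 = x\<close>, lift repeatedly under \<open>f ^^ m\<close>: \<open>v (t + 1)\<close> is a preimage of \<open>v t\<close> near
  \<open>v t\<close>. The hypothesis \<open>lift_const / \<Lambda> ^ m \<le> 1 / 2\<close> makes the steps shrink geometrically, and a
  limit point of the sequence is fixed by \<open>f ^^ m\<close>.
\<close>

proposition closing:
  assumes contract: "lift_const / \<Lambda> ^ m \<le> 1 / 2" and small: "d ((f ^^ m) x) x < 1 / L"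
  obtains q where "(f ^^ m) q = q"
    "\<And>i. i \<le> m \<Longrightarrow>
      d ((f ^^ i) x) ((f ^^ i) q) \<le> 2 * lift_const * d ((f ^^ m) x) x / \<Lambda> ^ (m - i)"
proof -
  define e where "e = d ((f ^^ m) x) x"
  have e0: "0 \<le> e" by (simp add: e_def)
  have "\<exists>v. \<forall>t. ((t = 0 \<longrightarrow> v t = x) \<and> d ((f ^^ m) (v t)) (v t) \<le> e / 2 ^ t) \<and>
    (\<forall>i\<le>m. d ((f ^^ i) (v t)) ((f ^^ i) (v (Suc t))) \<le> lift_const * e / \<Lambda> ^ (m - i) / 2 ^ t)"
  proof (rule dependent_nat_choice[where P = "\<lambda>t u. (t = 0 \<longrightarrow> u = x) \<and> d ((f ^^ m) u) u \<le> e / 2 ^ t"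
          and Q = "\<lambda>t u v. \<forall>i\<le>m. d ((f ^^ i) u) ((f ^^ i) v) \<le> lift_const * e / \<Lambda> ^ (m - i) / 2 ^ t"])
    fix u t
    assume u: "(t = 0 \<longrightarrow> u = x) \<and> d ((f ^^ m) u) u \<le> e / 2 ^ t"
    have "e / 2 ^ t \<le> e"
      using mult_left_mono[of 1 "2 ^ t" e] e0 by (simp add: pos_divide_le_eq)
    then have "d ((f ^^ m) u) u < 1 / L"
      using u small e_def by linarith
    then obtain v where v: "(f ^^ m) v = u"
      "\<And>i. i \<le> m \<Longrightarrow> d ((f ^^ i) u) ((f ^^ i) v) \<le> lift_const * d ((f ^^ m) u) u / \<Lambda> ^ (m - i)"
      using contracting_lift by blast
    have close: "d ((f ^^ i) u) ((f ^^ i) v) \<le> lift_const * e / \<Lambda> ^ (m - i) / 2 ^ t" if "i \<le> m" for i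
    proof -
      have "d ((f ^^ i) u) ((f ^^ i) v) \<le> lift_const * (e / 2 ^ t) / \<Lambda> ^ (m - i)"
        using u lift_const_ge \<Lambda>
        by (intro order.trans[OF v(2)[OF that]] divide_right_mono mult_left_mono) auto
      then show ?thesis by (simp add: field_simps)
    qed
    have "d u v \<le> (lift_const / \<Lambda> ^ m) * (e / 2 ^ t)"
      using close[of 0] by (simp add: field_simps)
    also have "\<dots> \<le> (1 / 2) * (e / 2 ^ t)"
      using contract e0 by (intro mult_right_mono) auto
    finally have "d ((f ^^ m) v) v \<le> e / 2 ^ Suc t"
      using v(1) by simp
    then show "\<exists>v. ((Suc t = 0 \<longrightarrow> v = x) \<and> d ((f ^^ m) v) v \<le> e / 2 ^ Suc t) \<and>
      (\<forall>i\<le>m. d ((f ^^ i) u) ((f ^^ i) v) \<le> lift_const * e / \<Lambda> ^ (m - i) / 2 ^ t)"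
      using close by blast
  qed (auto simp: e_def)
  then obtain v where v0: "v 0 = x"
    and vclose: "\<And>t. d ((f ^^ m) (v t)) (v t) \<le> e / 2 ^ t"
    and vi: "\<And>t i. i \<le> m \<Longrightarrow>
      d ((f ^^ i) (v t)) ((f ^^ i) (v (Suc t))) \<le> lift_const * e / \<Lambda> ^ (m - i) / 2 ^ t"
    by blast
  have total: "d ((f ^^ i) x) ((f ^^ i) (v t)) \<le> 2 * lift_const * e / \<Lambda> ^ (m - i)" if "i \<le> m" for i t
  proof -
    define b where "b = lift_const * e / \<Lambda> ^ (m - i)"
    have "0 \<le> b"
      using e0 lift_const_ge \<Lambda> by (simp add: b_def)
    have "d ((f ^^ i) x) ((f ^^ i) (v t)) \<le> 2 * b - 2 * b / 2 ^ t"
    proof (induction t)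
      case (Suc t)
      have "d ((f ^^ i) x) ((f ^^ i) (v (Suc t)))
        \<le> d ((f ^^ i) x) ((f ^^ i) (v t)) + d ((f ^^ i) (v t)) ((f ^^ i) (v (Suc t)))"
        by (intro triangle) auto
      also have "\<dots> \<le> (2 * b - 2 * b / 2 ^ t) + b / 2 ^ t"
        using Suc vi[OF that, of t] by (intro add_mono) (auto simp: b_def)
      finally show ?case by (simp add: field_simps)
    qed (simp add: v0)
    also have "\<dots> \<le> 2 * b" using \<open>0 \<le> b\<close> by simp
    finally show ?thesis by (simp add: b_def)
  qed
  obtain q r where r: "strict_mono (r :: nat \<Rightarrow> nat)" and q: "limitin mtopology (v \<circ> r) q sequentially"
  proof -
    have "compactin mtopology UNIV"
      using compact by (simp add: compact_space_def)
    from compactin_subsequence[OF this, of v] show ?thesis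
      using that by blast
  qed
  have "limitin mtopology (\<lambda>t. (f ^^ m) (v (r t))) q sequentially"
  proof (rule limitin_nearby[OF q])
    have "(\<lambda>t. e / 2 ^ t) \<longlonglongrightarrow> 0"
      by real_asymp
    then have "(\<lambda>t. e / 2 ^ r t) \<longlonglongrightarrow> 0"
      using LIMSEQ_subseq_LIMSEQ[OF _ r, of "\<lambda>t. e / 2 ^ t"] by (simp add: o_def)
    then show "(\<lambda>t. d ((v \<circ> r) t) ((f ^^ m) (v (r t)))) \<longlonglongrightarrow> 0"
      by (rule Lim_null_comparison[rotated]) (use vclose in \<open>simp add: commute\<close>)
  qed
  moreover have "limitin mtopology (\<lambda>t. (f ^^ m) (v (r t))) ((f ^^ m) q) sequentially"
    using limitin_iterate[OF q] by (simp add: o_def)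
  ultimately have "(f ^^ m) q = q"
    using limitin_metric_unique by (metis trivial_limit_sequentially)
  moreover have "d ((f ^^ i) x) ((f ^^ i) q) \<le> 2 * lift_const * e / \<Lambda> ^ (m - i)" if "i \<le> m" for i
    using limitin_dist_le[OF limitin_iterate[OF q]] total[OF that] by simp
  ultimately show ?thesis
    using that unfolding e_def by blast
qed

text \<open>
  Lifting from the end of the chain backwards: a point near \<open>x (i + 1)\<close> is near \<open>(f ^^ n) (x i)\<close>, so
  it has a preimage near \<open>x i\<close>. One lift halves the error \<open>2 * \<epsilon>\<close>, which leaves room for the
  next jump.
\<close>

lemma chain_shadowing:
  assumes contract: "lift_const / \<Lambda> ^ n \<le> 1 / 2" and \<epsilon>: "0 \<le> \<epsilon>" "2 * \<epsilon> < 1 / L"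
    and "\<And>i. i < p \<Longrightarrow> d ((f ^^ n) (x i)) (x (Suc i)) \<le> \<epsilon>"
  shows "\<exists>w. (f ^^ (n * p)) w = x p \<and> d w (x 0) \<le> \<epsilon> \<and>
    (\<forall>i<p. \<forall>l\<le>n. d ((f ^^ (n * i + l)) w) ((f ^^ l) (x i)) \<le> 2 * lift_const * \<epsilon>)"
  using assms(4)
proof (induction p arbitrary: x)
  case 0
  then show ?case using \<epsilon> by (intro exI[of _ "x 0"]) auto
next
  case (Suc p)
  from Suc.IH[of "x \<circ> Suc"] Suc.prems obtain w where w: "(f ^^ (n * p)) w = x (Suc p)"
    "d w (x 1) \<le> \<epsilon>"
    "\<And>i l. i < p \<Longrightarrow> l \<le> n \<Longrightarrow> d ((f ^^ (n * i + l)) w) ((f ^^ l) (x (Suc i))) \<le> 2 * lift_const * \<epsilon>"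
    by auto
  have jump: "d ((f ^^ n) (x 0)) w \<le> 2 * \<epsilon>"
    using triangle[of "(f ^^ n) (x 0)" "x 1" w] Suc.prems[of 0] w(2) by (simp add: commute)
  then obtain w' where w': "(f ^^ n) w' = w"
    "\<And>i. i \<le> n \<Longrightarrow> d ((f ^^ i) (x 0)) ((f ^^ i) w')
      \<le> lift_const * d ((f ^^ n) (x 0)) w / \<Lambda> ^ (n - i)"
    using contracting_lift[of n "x 0" w] \<epsilon>(2) by auto
  have near: "d ((f ^^ l) w') ((f ^^ l) (x 0)) \<le> 2 * lift_const * \<epsilon> / \<Lambda> ^ (n - l)" if "l \<le> n" for l
  proof -
    have "d ((f ^^ l) w') ((f ^^ l) (x 0)) \<le> lift_const * d ((f ^^ n) (x 0)) w / \<Lambda> ^ (n - l)"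
      using w'(2)[OF that] by (simp add: commute)
    also have "\<dots> \<le> lift_const * (2 * \<epsilon>) / \<Lambda> ^ (n - l)"
      using jump lift_const_ge \<Lambda> by (intro divide_right_mono mult_left_mono) auto
    finally show ?thesis by (simp add: mult_ac)
  qed
  show ?case
  proof (intro exI[of _ w'] conjI allI impI)
    have "(f ^^ (n * Suc p)) w' = (f ^^ (n * p)) ((f ^^ n) w')"
      by (metis add.commute comp_apply funpow_add mult_Suc_right)
    then show "(f ^^ (n * Suc p)) w' = x (Suc p)"
      using w w' by simp
    have "d w' (x 0) \<le> (lift_const / \<Lambda> ^ n) * (2 * \<epsilon>)"
      using near[of 0] by (simp add: mult_ac)
    also have "\<dots> \<le> (1 / 2) * (2 * \<epsilon>)"
      using contract \<epsilon> by (intro mult_right_mono) auto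
    finally show "d w' (x 0) \<le> \<epsilon>" by simp
    fix i l
    assume il: "i < Suc p" "l \<le> n"
    show "d ((f ^^ (n * i + l)) w') ((f ^^ l) (x i)) \<le> 2 * lift_const * \<epsilon>"
    proof (cases i)
      case 0
      then show ?thesis
        using order.trans[OF near[OF il(2)] contracted_le] \<epsilon> lift_const_ge by simp
    next
      case (Suc j)
      have "(f ^^ (n * i + l)) w' = (f ^^ (n * j + l)) ((f ^^ n) w')"
        by (metis Suc add.commute add.left_commute comp_apply funpow_add mult_Suc_right)
      then show ?thesis
        using w(3)[of j l] w'(1) Suc il by simp
    qed
  qed
qed

proposition periodic_chain_shadowing:
  assumes contract: "lift_const / \<Lambda> ^ n \<le> 1 / 2" and \<epsilon>: "0 \<le> \<epsilon>" "2 * \<epsilon> < 1 / L"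
    and jumps: "\<And>i. i < p \<Longrightarrow> d ((f ^^ n) (x i)) (x (Suc i)) \<le> \<epsilon>"
    and p: "1 \<le> p" "x p = x 0" and n: "1 \<le> n"
  obtains q where "(f ^^ (n * p)) q = q"
    "\<And>i l. i < p \<Longrightarrow> l \<le> n \<Longrightarrow> d ((f ^^ (n * i + l)) q) ((f ^^ l) (x i)) \<le> 4 * lift_const * \<epsilon>"
proof -
  obtain w where w: "(f ^^ (n * p)) w = x 0" "d w (x 0) \<le> \<epsilon>"
    "\<And>i l. i < p \<Longrightarrow> l \<le> n \<Longrightarrow> d ((f ^^ (n * i + l)) w) ((f ^^ l) (x i)) \<le> 2 * lift_const * \<epsilon>"
    using chain_shadowing[of n \<epsilon> p x] contract \<epsilon> jumps p(2) by auto
  have "lift_const / \<Lambda> ^ (n * p) \<le> lift_const / \<Lambda> ^ n"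
    using \<Lambda> p(1) lift_const_ge by (intro divide_left_mono power_increasing mult_pos_pos) auto
  then have contract': "lift_const / \<Lambda> ^ (n * p) \<le> 1 / 2"
    using contract by linarith
  have jump: "d ((f ^^ (n * p)) w) w \<le> \<epsilon>"
    using w by (simp add: commute)
  then have "d ((f ^^ (n * p)) w) w < 1 / L"
    using \<epsilon> by linarith
  with contract' obtain q where q: "(f ^^ (n * p)) q = q"
    "\<And>i. i \<le> n * p \<Longrightarrow> d ((f ^^ i) w) ((f ^^ i) q)
      \<le> 2 * lift_const * d ((f ^^ (n * p)) w) w / \<Lambda> ^ (n * p - i)"
    using closing by blast
  have "d ((f ^^ (n * i + l)) q) ((f ^^ l) (x i)) \<le> 4 * lift_const * \<epsilon>" if "i < p" "l \<le> n" for i l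
  proof -
    have le: "n * i + l \<le> n * p"
      using that by (metis Suc_leI add_le_cancel_left le_trans mult_Suc_right mult_le_mono2 add.commute)
    have "d ((f ^^ (n * i + l)) w) ((f ^^ (n * i + l)) q)
      \<le> 2 * lift_const * d ((f ^^ (n * p)) w) w"
      using lift_const_ge by (intro order.trans[OF q(2)[OF le] contracted_le]) auto
    also have "\<dots> \<le> 2 * lift_const * \<epsilon>"
      using jump lift_const_ge by (intro mult_left_mono) auto
    finally show ?thesis
      using w(3)[OF that] triangle[of "(f ^^ (n * i + l)) q" "(f ^^ (n * i + l)) w" "(f ^^ l) (x i)"]
      by (simp add: commute)
  qed
  then show ?thesis
    using that q(1) by blast
qed

end

section \<open>Sums along periodic orbits\<close>

text \<open>
  The infimum over pairs of distinct points is attained because the orbit is finite; for a single point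
  it is infinite and the gap is \<open>r\<close>.
\<close>

lemma rt_gap_cases:
  assumes "finite Orb" and "0 < \<theta>"
  obtains "rt_gap d r \<theta> Orb = r"
  | x y where "x \<in> Orb" "y \<in> Orb" "x \<noteq> y" "rt_gap d r \<theta> Orb = \<theta> * d x y"
proof -
  define G where "G = {ereal (d x y) | x y. x \<in> Orb \<and> y \<in> Orb \<and> x \<noteq> y}"
  have gap: "gap d Orb = Inf G"
    by (simp add: gap_def G_def)
  have "G \<subseteq> (\<lambda>(x, y). ereal (d x y)) ` (Orb \<times> Orb)"
    by (auto simp: G_def)
  then have fin: "finite G"
    using assms by (meson finite_SigmaI finite_imageI finite_subset)
  show ?thesis
  proof (cases "G = {}")
    case False
    then have "Inf G \<in> G"
      using fin by (simp add: cInf_eq_Min)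
    then obtain x y where xy: "x \<in> Orb" "y \<in> Orb" "x \<noteq> y" "Inf G = ereal (d x y)"
      unfolding G_def by blast
    then have "rt_gap d r \<theta> Orb = min r (\<theta> * d x y)"
      by (simp add: rt_gap_def gap min_def)
    then show ?thesis
      using that xy by (metis min_def)
  next
    case True
    then have "rt_gap d r \<theta> Orb = r"
      using \<open>0 < \<theta>\<close> by (simp add: rt_gap_def gap top_ereal_def)
    then show ?thesis using that by blast
  qed
qed

lemma sum_orbit_segment_le:
  fixes g :: "'a \<Rightarrow> real"
  assumes per: "(f ^^ m) q = q" and "k \<le> m" and nonneg: "\<And>x. 0 \<le> g x"
  shows "(\<Sum>i<k. g ((f ^^ i) ((f ^^ b) q))) \<le> (\<Sum>i<m. g ((f ^^ i) q))"
proof -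
  have "(\<Sum>i<m. g ((f ^^ i) ((f ^^ b) q))) = (\<Sum>i<m. g ((f ^^ i) q))"
  proof (induction b)
    case (Suc b)
    define x where "x = (f ^^ b) q"
    have "(f ^^ m) x = (f ^^ b) ((f ^^ m) q)"
      unfolding x_def by (metis add.commute comp_apply funpow_add)
    then have x: "(f ^^ m) x = x"
      by (simp add: per x_def)
    have "(\<Sum>i<m. g ((f ^^ i) ((f ^^ Suc b) q))) = (\<Sum>i<m. g ((f ^^ Suc i) x))"
      by (simp add: x_def funpow_swap1)
    also have "\<dots> = (\<Sum>i<Suc m. g ((f ^^ i) x)) - g x"
      by (simp only: sum.lessThan_Suc_shift) simp
    also have "\<dots> = (\<Sum>i<m. g ((f ^^ i) x))"
      by (simp add: x)
    finally show ?case
      using Suc by (simp add: x_def)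
  qed simp
  moreover have "(\<Sum>i<k. g ((f ^^ i) ((f ^^ b) q))) \<le> (\<Sum>i<m. g ((f ^^ i) ((f ^^ b) q)))"
    using assms by (intro sum_mono2) auto
  ultimately show ?thesis by simp
qed

text \<open>
  The two points cut the cycle into two arcs, and the shorter one has at most half the length.
\<close>

lemma periodic_orbit_halving:
  assumes per: "(f ^^ m) q = q"
    and xy: "x \<in> {(f ^^ i) q | i. i < m}" "y \<in> {(f ^^ i) q | i. i < m}" "x \<noteq> y"
    and sym: "\<And>x y. d x y = d y x"
  obtains b k where "1 \<le> k" "2 * k \<le> m" "d ((f ^^ k) ((f ^^ b) q)) ((f ^^ b) q) = d x y"
proof -
  have ordered: "\<exists>k b. 1 \<le> k \<and> 2 * k \<le> m \<and> d ((f ^^ k) ((f ^^ b) q)) ((f ^^ b) q) = d x y"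
    if "x = (f ^^ a) q" "y = (f ^^ b) q" "a < b" "b < m" for a b x y
  proof (cases "2 * (b - a) \<le> m")
    case True
    have "(f ^^ (b - a)) x = y"
      using that by (metis add.commute comp_apply funpow_add le_add_diff_inverse less_imp_le)
    then show ?thesis
      using True that sym[of x y] by (intro exI[of _ "b - a"] exI[of _ a]) auto
  next
    case False
    have "m - (b - a) + b = a + m"
      using that by simp
    then have "(f ^^ (m - (b - a))) y = (f ^^ a) ((f ^^ m) q)"
      using that by (metis comp_apply funpow_add)
    then have "(f ^^ (m - (b - a))) y = x"
      using per that by simp
    then show ?thesis
      using False that by (intro exI[of _ "m - (b - a)"] exI[of _ b]) auto
  qed
  from xy obtain a b where "x = (f ^^ a) q" "y = (f ^^ b) q" "a < m" "b < m" "a \<noteq> b"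
    by blast
  then have "\<exists>k b. 1 \<le> k \<and> 2 * k \<le> m \<and> d ((f ^^ k) ((f ^^ b) q)) ((f ^^ b) q) = d x y"
    using ordered[of x a y b] ordered[of y b x a] sym[of x y] by (metis linorder_neqE_nat)
  then show ?thesis using that by blast
qed

text \<open>
  Bounds the total cost of closing up an orbit segment: the shadowing errors decay geometrically away from
  the end of the segment.
\<close>

lemma geometric_powr_sum_le:
  fixes c \<Lambda> \<alpha> e :: real
  assumes "0 \<le> c" "1 < \<Lambda>" "0 < \<alpha>" "0 \<le> e"
  shows "(\<Sum>i<k. (c * e / \<Lambda> ^ (k - i)) powr \<alpha>) \<le> c powr \<alpha> / (1 - \<Lambda> powr - \<alpha>) * e powr \<alpha>"
proof -
  define b where "b = \<Lambda> powr - \<alpha>"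
  have b: "0 \<le> b" "b < 1"
    using assms by (auto simp: b_def powr_less_one)
  have term_eq: "(c * e / \<Lambda> ^ j) powr \<alpha> = c powr \<alpha> * e powr \<alpha> * b ^ j" for j
  proof -
    have "(\<Lambda> ^ j) powr \<alpha> = (\<Lambda> powr \<alpha>) ^ j"
      using assms by (simp add: powr_powr powr_realpow[symmetric] mult.commute)
    then show ?thesis
      using assms by (simp add: powr_mult powr_divide b_def powr_minus_divide power_divide)
  qed
  have "(\<Sum>i<k. b ^ (k - i)) \<le> (\<Sum>j<Suc k. b ^ j)"
  proof -
    have "(\<Sum>i<k. b ^ (k - i)) = (\<Sum>j<k. b ^ Suc j)"
      by (subst sum.nat_diff_reindex[symmetric]) (simp add: Suc_diff_Suc)
    also have "\<dots> \<le> (\<Sum>j<Suc k. b ^ j)"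
      by (simp only: sum.lessThan_Suc_shift) simp
    finally show ?thesis .
  qed
  also have "\<dots> \<le> 1 / (1 - b)"
    using b by (simp add: sum_gp_strict divide_right_mono del: sum.lessThan_Suc)
  finally have geom: "(\<Sum>i<k. b ^ (k - i)) \<le> 1 / (1 - b)" .
  have "(\<Sum>i<k. (c * e / \<Lambda> ^ (k - i)) powr \<alpha>) = c powr \<alpha> * e powr \<alpha> * (\<Sum>i<k. b ^ (k - i))"
    by (simp only: term_eq sum_distrib_left)
  also have "\<dots> \<le> c powr \<alpha> * e powr \<alpha> * (1 / (1 - b))"
    using geom by (intro mult_left_mono) auto
  finally show ?thesis
    by (simp add: b_def)
qed

lemma powr_add_le:
  fixes a b \<alpha> :: real
  assumes "0 \<le> a" "0 \<le> b" "0 < \<alpha>" "\<alpha> \<le> 1"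
  shows "(a + b) powr \<alpha> \<le> a powr \<alpha> + b powr \<alpha>"
proof (cases "a + b = 0")
  case False
  define s where "s = a + b"
  have s: "0 < s" "a \<le> s" "b \<le> s" using assms False by (auto simp: s_def)
  have frac: "t / s \<le> (t / s) powr \<alpha>" if "0 \<le> t" "t \<le> s" for t
  proof (cases "t = 0")
    case False
    then have "(t / s) powr 1 \<le> (t / s) powr \<alpha>"
      using that s assms by (intro powr_mono') auto
    then show ?thesis using that s False by simp
  qed simp
  have "1 = a / s + b / s"
    using s by (simp add: s_def add_divide_distrib[symmetric])
  also have "\<dots> \<le> (a / s) powr \<alpha> + (b / s) powr \<alpha>"
    using assms s by (intro add_mono frac) auto
  also have "\<dots> = (a powr \<alpha> + b powr \<alpha>) / s powr \<alpha>"
    using assms s by (simp add: powr_divide add_divide_distrib)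
  finally show ?thesis
    using s by (simp add: s_def[symmetric] pos_le_divide_eq)
qed (use assms in simp)

section \<open>Periodic orbits close to an invariant set\<close>

context visual_tiling
begin

lemma point_distance_nonneg: "K \<noteq> {} \<Longrightarrow> 0 \<le> point_distance d x K"
  unfolding point_distance_def by (intro cINF_greatest) auto

lemma point_distance_le: "a \<in> K \<Longrightarrow> point_distance d x K \<le> d x a"
  unfolding point_distance_def by (intro cINF_lower bdd_belowI2[of _ 0]) auto

lemma point_distance_less_iff:
  assumes "K \<noteq> {}"
  shows "point_distance d x K < \<eta> \<longleftrightarrow> (\<exists>a\<in>K. d x a < \<eta>)"
  unfolding point_distance_def using assms by (intro cINF_less_iff bdd_belowI2[of _ 0]) auto

lemma point_distance_triangle:
  assumes "K \<noteq> {}"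
  shows "point_distance d x K \<le> d x y + point_distance d y K"
proof -
  have "point_distance d x K - d x y \<le> point_distance d y K"
    unfolding point_distance_def[of d y]
  proof (intro cINF_greatest assms)
    fix a assume "a \<in> K"
    then show "point_distance d x K - d x y \<le> d y a"
      using point_distance_le[of a K x] triangle[of x y a] by simp
  qed
  then show ?thesis by simp
qed

lemma fine_finite_labelling:
  assumes "0 < \<epsilon>"
  obtains \<xi> :: "'a \<Rightarrow> 'a" where "finite (range \<xi>)" "\<And>x y. \<xi> x = \<xi> y \<Longrightarrow> d x y < \<epsilon>"
proof -
  have "mtotally_bounded UNIV"
    using compact compactin_imp_mtotally_bounded unfolding compact_space_def by simp
  then obtain F where F: "finite F" "UNIV \<subseteq> (\<Union>x\<in>F. mball x (\<epsilon> / 2))"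
    using assms unfolding mtotally_bounded_def by (metis half_gt_zero)
  then have "\<forall>x. \<exists>c. c \<in> F \<and> d c x < \<epsilon> / 2"
    by (auto simp: subset_iff)
  then obtain \<xi> where \<xi>: "\<And>x. \<xi> x \<in> F" "\<And>x. d (\<xi> x) x < \<epsilon> / 2"
    by metis
  show ?thesis
  proof (rule that[of \<xi>])
    show "finite (range \<xi>)"
      using \<xi>(1) F(1) by (metis finite_subset image_subset_iff)
    fix x y assume "\<xi> x = \<xi> y"
    then show "d x y < \<epsilon>"
      using \<xi>(2)[of x] \<xi>(2)[of y] triangle[of x "\<xi> x" y] by (simp add: commute)
  qed
qed

lemma eventually_contracted: "\<forall>\<^sub>F n in sequentially. c / \<Lambda> ^ n < e" if "0 < e"
proof -
  have "(\<lambda>n. c / \<Lambda> ^ n) \<longlonglongrightarrow> 0"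
    using LIMSEQ_divide_realpow_zero[OF \<Lambda>] .
  then show ?thesis
    using order_tendstoD(2) that by blast
qed

text \<open>
  Apply \<open>short_itinerary_cycle\<close> with a rate \<open>\<gamma>\<close> so small that the power of the period,
  of order \<open>exp (\<gamma> * (\<beta> + 1) * n)\<close> up to a power of \<open>n\<close>, is beaten by the distance \<open>\<Lambda> ^ (-n)\<close>
  raised to \<open>\<alpha>\<close>.
\<close>

lemma superpolynomial_periodic_approximation:
  assumes "K \<noteq> {}" and inv: "f ` K \<subseteq> K"
    and \<rho>: "0 < \<rho>" and inj: "\<And>a. a \<in> K \<Longrightarrow> inj_on f (mball a \<rho>)"
    and \<alpha>: "0 < \<alpha>" and \<beta>: "0 \<le> \<beta>" and s: "0 < s"
  obtains q m where "1 \<le> m" "(f ^^ m) q = q"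
    "real m powr \<beta> * (\<Sum>i<m. point_distance d ((f ^^ i) q) K powr \<alpha>) \<le> s"
proof -
  \<comment> \<open>Pieces so small that backward contraction applies to points with equal itineraries.\<close>
  define \<delta> where "\<delta> = min (\<rho> / lift_const) (1 / L)"
  have \<delta>: "0 < \<delta>" "lift_const * \<delta> \<le> \<rho>" "\<delta> \<le> 1 / L"
    using \<rho> L lift_const_ge by (auto simp: \<delta>_def min_def field_simps)
  obtain \<xi> :: "'a \<Rightarrow> 'a" where \<xi>: "finite (range \<xi>)" "\<And>x y. \<xi> x = \<xi> y \<Longrightarrow> d x y < \<delta>"
    using fine_finite_labelling[OF \<delta>(1)] by blast
  define \<gamma> where "\<gamma> = \<alpha> * ln \<Lambda> / (2 * (\<beta> + 1))"
  have \<gamma>: "0 < \<gamma>"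
    using \<alpha> \<beta> \<Lambda> by (simp add: \<gamma>_def)
  define D where "D = 4 * lift_const\<^sup>2 * \<delta> * \<Lambda>"
  have D: "0 < D"
    using \<delta>(1) lift_const_ge \<Lambda> by (simp add: D_def)
  \<comment> \<open>Itineraries of length n control only n - 1 backward steps, hence the additional factor.\<close>
  define \<epsilon> where "\<epsilon> n = lift_const * \<delta> * \<Lambda> / \<Lambda> ^ n" for n
  have "\<forall>\<^sub>F n in sequentially. lift_const / \<Lambda> ^ n < 1 / 2"
    by (rule eventually_contracted) simp
  moreover have "\<forall>\<^sub>F n in sequentially. \<epsilon> n < 1 / (2 * L)"
    unfolding \<epsilon>_def using L by (intro eventually_contracted) auto
  moreover have "\<forall>\<^sub>F n in sequentially.
    (4 * real n * exp (\<gamma> * n)) powr (\<beta> + 1) * (D / \<Lambda> ^ n) powr \<alpha> < s"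
  proof -
    define c where "c = \<alpha> * ln \<Lambda> / 2"
    define b where "b = \<beta> + 1"
    have c: "0 < c" and b: "0 < b"
      using \<alpha> \<beta> \<Lambda> by (auto simp: c_def b_def)
    have "(\<lambda>n. 4 powr b * D powr \<alpha> * (real n powr b * exp (- c * real n))) \<longlonglongrightarrow> 0"
      using b c by real_asymp
    then have "\<forall>\<^sub>F n in sequentially. 4 powr b * D powr \<alpha> * (real n powr b * exp (- c * real n)) < s"
      using order_tendstoD(2) s by blast
    moreover have "(4 * real n * exp (\<gamma> * n)) powr (\<beta> + 1) * (D / \<Lambda> ^ n) powr \<alpha>
      = 4 powr b * D powr \<alpha> * (real n powr b * exp (- c * real n))" for n
    proof -
      have "\<gamma> * b = c"
        unfolding \<gamma>_def c_def b_def[symmetric] using b by simp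
      then have "exp (\<gamma> * n) powr b = exp (c * n)"
        by (simp add: powr_def mult_ac)
      moreover have "(\<Lambda> ^ n) powr \<alpha> = exp (c * n) * exp (c * n)"
        using \<Lambda> by (simp add: powr_def c_def ln_realpow mult_ac flip: exp_add)
      ultimately show ?thesis
        unfolding b_def[symmetric] using D \<Lambda> by (simp add: powr_mult powr_divide exp_minus field_simps)
    qed
    ultimately show ?thesis by simp
  qed
  ultimately have "\<forall>\<^sub>F n in sequentially. lift_const / \<Lambda> ^ n < 1 / 2 \<and> \<epsilon> n < 1 / (2 * L) \<and>
    (4 * real n * exp (\<gamma> * n)) powr (\<beta> + 1) * (D / \<Lambda> ^ n) powr \<alpha> < s"
    by eventually_elim simp
  then obtain N where N: "\<And>n. N \<le> n \<Longrightarrow> lift_const / \<Lambda> ^ n < 1 / 2 \<and> \<epsilon> n < 1 / (2 * L) \<and>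
    (4 * real n * exp (\<gamma> * n)) powr (\<beta> + 1) * (D / \<Lambda> ^ n) powr \<alpha> < s"
    unfolding eventually_sequentially by blast
  obtain n k x where n: "Suc N \<le> n" and k: "1 \<le> k" "real k \<le> 2 * (exp (\<gamma> * n) + 1)"
    and x: "\<And>i. i \<le> k \<Longrightarrow> x i \<in> K" "x k = x 0"
      "\<And>i. i < k \<Longrightarrow> itinerary \<xi> f n ((f ^^ n) (x i)) = itinerary \<xi> f n (x (Suc i))"
  proof (rule short_itinerary_cycle[of K f \<xi> \<gamma> "Suc N"])
    show "finite (\<xi> ` K)"
      using \<xi>(1) by (rule finite_subset[rotated]) auto
  qed (use assms(1) inv \<gamma> in auto)
  have n1: "1 \<le> n" "N \<le> n" using n by auto
  have inK: "(f ^^ i) a \<in> K" if "a \<in> K" for a i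
    using funpow_in_invariant[OF inv that] .
  have jump: "d ((f ^^ n) (x i)) (x (Suc i)) \<le> \<epsilon> n" if "i < k" for i
  proof -
    define u where "u = (f ^^ n) (x i)"
    have u: "u \<in> K"
      using inK x(1)[of i] that by (simp add: u_def)
    have same: "\<xi> ((f ^^ j) u) = \<xi> ((f ^^ j) (x (Suc i)))" if "j < n" for j
      using x(3)[OF \<open>i < k\<close>] that unfolding itinerary_eq_iff u_def by blast
    have "d u (x (Suc i)) \<le> lift_const * \<delta> / \<Lambda> ^ (n - 1)"
    proof (rule backward_contraction[OF _ _ \<delta>(2,3)])
      show "inj_on f (mball ((f ^^ j) u) \<rho>)" for j
        using inj inK[OF u] by blast
      show "d ((f ^^ j) u) ((f ^^ j) (x (Suc i))) < \<delta>" if "j \<le> n - 1" for j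
        using same[of j] that n1 \<xi>(2) by simp
    qed
    also have "\<dots> = \<epsilon> n"
      using n1(1) \<Lambda> by (cases n) (auto simp: \<epsilon>_def)
    finally show ?thesis by (simp add: u_def)
  qed
  have "0 \<le> \<epsilon> n"
    using lift_const_ge \<delta>(1) \<Lambda> by (simp add: \<epsilon>_def)
  moreover have "2 * \<epsilon> n < 1 / L"
    using N[OF n1(2)] L by (simp add: field_simps)
  moreover have "lift_const / \<Lambda> ^ n \<le> 1 / 2"
    using N[OF n1(2)] by simp
  ultimately obtain q where q: "(f ^^ (n * k)) q = q"
    "\<And>i l. i < k \<Longrightarrow> l \<le> n \<Longrightarrow> d ((f ^^ (n * i + l)) q) ((f ^^ l) (x i)) \<le> 4 * lift_const * \<epsilon> n"
    using periodic_chain_shadowing[of n "\<epsilon> n" k x] jump k(1) x(2) n1(1) by blast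
  define m where "m = n * k"
  have near: "point_distance d ((f ^^ j) q) K \<le> D / \<Lambda> ^ n" if "j < m" for j
  proof -
    have i: "j div n < k" "j mod n \<le> n"
      using that n1(1) by (auto simp: m_def less_mult_imp_div_less mult.commute less_imp_le)
    have "point_distance d ((f ^^ j) q) K \<le> d ((f ^^ j) q) ((f ^^ (j mod n)) (x (j div n)))"
      using i x(1) inK by (intro point_distance_le) simp
    also have "\<dots> \<le> 4 * lift_const * \<epsilon> n"
      using q(2)[OF i] by simp
    also have "\<dots> = D / \<Lambda> ^ n"
      by (simp add: D_def \<epsilon>_def power2_eq_square)
    finally show ?thesis .
  qed
  have m1: "1 \<le> m"
    using n1(1) k(1) by (simp add: m_def)
  have "(\<Sum>i<m. point_distance d ((f ^^ i) q) K powr \<alpha>) \<le> (\<Sum>i<m. (D / \<Lambda> ^ n) powr \<alpha>)"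
    using near point_distance_nonneg[OF assms(1)] \<alpha> by (intro sum_mono powr_mono2) auto
  then have "real m powr \<beta> * (\<Sum>i<m. point_distance d ((f ^^ i) q) K powr \<alpha>)
    \<le> real m powr \<beta> * (m * (D / \<Lambda> ^ n) powr \<alpha>)"
    by (intro mult_left_mono) auto
  also have "\<dots> = real m powr (\<beta> + 1) * (D / \<Lambda> ^ n) powr \<alpha>"
    using m1 by (simp add: powr_add)
  also have "\<dots> \<le> (4 * real n * exp (\<gamma> * n)) powr (\<beta> + 1) * (D / \<Lambda> ^ n) powr \<alpha>"
  proof (intro mult_right_mono powr_mono2)
    have "1 \<le> exp (\<gamma> * real n)"
      using \<gamma> by simp
    then have "real k \<le> 4 * exp (\<gamma> * n)"
      using k(2) by argo
    then have "real n * real k \<le> real n * (4 * exp (\<gamma> * n))"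
      by (intro mult_left_mono) auto
    then show "real m \<le> 4 * real n * exp (\<gamma> * n)"
      by (simp add: m_def mult_ac)
  qed (use \<beta> in auto)
  also have "\<dots> \<le> s"
    using N[OF n1(2)] by simp
  finally show ?thesis
    using that m1 q(1) unfolding m_def by blast
qed

text \<open>
  Otherwise compactness would produce a periodic point in \<open>K\<close>. This excludes the short orbit segments to
  which \<open>closing\<close> does not apply.
\<close>

lemma no_short_returns:
  assumes K: "compactin mtopology K" "K \<noteq> {}"
    and aper: "\<And>a k. a \<in> K \<Longrightarrow> 1 \<le> k \<Longrightarrow> (f ^^ k) a \<noteq> a"
  shows "\<exists>\<eta>>0. \<forall>x k. point_distance d x K < \<eta> \<longrightarrow> 1 \<le> k \<longrightarrow> k < k0 \<longrightarrow> \<eta> \<le> d ((f ^^ k) x) x"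
proof -
  have single: "\<exists>\<eta>>0. \<forall>x. point_distance d x K < \<eta> \<longrightarrow> \<eta> \<le> d ((f ^^ k) x) x" if "1 \<le> k" for k
  proof (rule ccontr)
    assume "\<not> ?thesis"
    then have "\<forall>j::nat. \<exists>x. point_distance d x K < 1 / Suc j \<and> d ((f ^^ k) x) x < 1 / Suc j"
      by (metis not_le of_nat_0_less_iff zero_less_Suc zero_less_divide_1_iff)
    then obtain x where x: "\<And>j::nat. point_distance d (x j) K < 1 / Suc j"
      "\<And>j::nat. d ((f ^^ k) (x j)) (x j) < 1 / Suc j"
      by metis
    then have "\<forall>j. \<exists>a\<in>K. d (x j) a < 1 / Suc j"
      using point_distance_less_iff[OF K(2)] by blast
    then obtain a where a: "\<And>j. a j \<in> K" "\<And>j. d (x j) (a j) < 1 / Suc j"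
      by metis
    obtain l r where l: "l \<in> K" and r: "strict_mono (r :: nat \<Rightarrow> nat)"
      and lim: "limitin mtopology (a \<circ> r) l sequentially"
      by (rule compactin_subsequence[of K a, OF K(1) a(1)])
    have null: "(\<lambda>j. u (r j)) \<longlonglongrightarrow> 0" if "\<And>j. 0 \<le> u j" "\<And>j. u j < 1 / Suc j" for u :: "nat \<Rightarrow> real"
    proof -
      have "u \<longlonglongrightarrow> 0"
      proof (rule Lim_null_comparison)
        show "\<forall>\<^sub>F j in sequentially. norm (u j) \<le> 1 / Suc j"
          using that less_imp_le by (intro always_eventually) auto
        show "(\<lambda>j. 1 / real (Suc j)) \<longlonglongrightarrow> 0"
          using LIMSEQ_inverse_real_of_nat by (simp add: inverse_eq_divide)
      qed
      then show ?thesis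
        using LIMSEQ_subseq_LIMSEQ[OF _ r] by (auto simp: o_def)
    qed
    have limx: "limitin mtopology (x \<circ> r) l sequentially"
    proof (rule limitin_nearby[OF lim])
      have "(\<lambda>j. d (a (r j)) (x (r j))) \<longlonglongrightarrow> 0"
        by (rule null[of "\<lambda>j. d (a j) (x j)"]) (use a(2) in \<open>auto simp: commute\<close>)
      then show "(\<lambda>j. d ((a \<circ> r) j) ((x \<circ> r) j)) \<longlonglongrightarrow> 0"
        by simp
    qed
    have "limitin mtopology (\<lambda>j. (f ^^ k) (x (r j))) l sequentially"
    proof (rule limitin_nearby[OF limx])
      have "(\<lambda>j. d (x (r j)) ((f ^^ k) (x (r j)))) \<longlonglongrightarrow> 0"
        by (rule null[of "\<lambda>j. d (x j) ((f ^^ k) (x j))"]) (use x(2) in \<open>auto simp: commute\<close>)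
      then show "(\<lambda>j. d ((x \<circ> r) j) ((f ^^ k) (x (r j)))) \<longlonglongrightarrow> 0"
        by simp
    qed
    moreover have "limitin mtopology (\<lambda>j. (f ^^ k) (x (r j))) ((f ^^ k) l) sequentially"
      using limitin_iterate[OF limx] by (simp add: o_def)
    ultimately have "(f ^^ k) l = l"
      using limitin_metric_unique by (metis trivial_limit_sequentially)
    then show False
      using aper l that by blast
  qed
  show ?thesis
  proof (induction k0)
    case (Suc k0)
    then obtain \<eta> where \<eta>: "0 < \<eta>"
      "\<And>x k. point_distance d x K < \<eta> \<Longrightarrow> 1 \<le> k \<Longrightarrow> k < k0 \<Longrightarrow> \<eta> \<le> d ((f ^^ k) x) x"
      by blast
    show ?case
    proof (cases "1 \<le> k0")
      case True
      then obtain \<eta>' where \<eta>': "0 < \<eta>'" "\<And>x. point_distance d x K < \<eta>' \<Longrightarrow> \<eta>' \<le> d ((f ^^ k0) x) x"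
        using single by blast
      have "min \<eta> \<eta>' \<le> d ((f ^^ k) x) x"
        if "point_distance d x K < min \<eta> \<eta>'" "1 \<le> k" "k < Suc k0" for x k
        using \<eta>(2)[of x k] \<eta>'(2)[of x] that by (cases "k = k0") auto
      then show ?thesis
        using \<eta>(1) \<eta>'(1) by (intro exI[of _ "min \<eta> \<eta>'"]) auto
    next
      case False
      then show ?thesis
        by (intro exI[of _ 1]) auto
    qed
  qed (intro exI[of _ 1], auto)
qed

lemma closed_up_orbit_near:
  assumes "K \<noteq> {}" and \<alpha>: "0 < \<alpha>" "\<alpha> \<le> 1"
    and contract: "lift_const / \<Lambda> ^ k \<le> 1 / 2" and small: "d ((f ^^ k) x) x < 1 / L"
  obtains q where "(f ^^ k) q = q"
    "(\<Sum>i<k. point_distance d ((f ^^ i) q) K powr \<alpha>)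
      \<le> (\<Sum>i<k. point_distance d ((f ^^ i) x) K powr \<alpha>)
        + (2 * lift_const) powr \<alpha> / (1 - \<Lambda> powr - \<alpha>) * d ((f ^^ k) x) x powr \<alpha>"
proof -
  define e where "e = d ((f ^^ k) x) x"
  obtain q where q: "(f ^^ k) q = q"
    "\<And>i. i \<le> k \<Longrightarrow> d ((f ^^ i) x) ((f ^^ i) q) \<le> 2 * lift_const * e / \<Lambda> ^ (k - i)"
    using closing[OF contract small] unfolding e_def by blast
  have "point_distance d ((f ^^ i) q) K powr \<alpha>
      \<le> point_distance d ((f ^^ i) x) K powr \<alpha> + (2 * lift_const * e / \<Lambda> ^ (k - i)) powr \<alpha>"
    if "i < k" for i
  proof -
    have "point_distance d ((f ^^ i) q) K
      \<le> d ((f ^^ i) q) ((f ^^ i) x) + point_distance d ((f ^^ i) x) K"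
      by (rule point_distance_triangle[OF assms(1)])
    also have "\<dots> \<le> point_distance d ((f ^^ i) x) K + 2 * lift_const * e / \<Lambda> ^ (k - i)"
      using q(2)[of i] that by (simp add: commute)
    finally have "point_distance d ((f ^^ i) q) K powr \<alpha>
      \<le> (point_distance d ((f ^^ i) x) K + 2 * lift_const * e / \<Lambda> ^ (k - i)) powr \<alpha>"
      using \<alpha>(1) point_distance_nonneg[OF assms(1)] by (intro powr_mono2) auto
    also have "\<dots> \<le> point_distance d ((f ^^ i) x) K powr \<alpha>
        + (2 * lift_const * e / \<Lambda> ^ (k - i)) powr \<alpha>"
      using \<alpha> point_distance_nonneg[OF assms(1)] lift_const_ge \<Lambda>
      by (intro powr_add_le) (auto simp: e_def)
    finally show ?thesis .
  qed
  then have "(\<Sum>i<k. point_distance d ((f ^^ i) q) K powr \<alpha>)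
      \<le> (\<Sum>i<k. point_distance d ((f ^^ i) x) K powr \<alpha> + (2 * lift_const * e / \<Lambda> ^ (k - i)) powr \<alpha>)"
    by (intro sum_mono) auto
  also have "\<dots> = (\<Sum>i<k. point_distance d ((f ^^ i) x) K powr \<alpha>)
      + (\<Sum>i<k. (2 * lift_const * e / \<Lambda> ^ (k - i)) powr \<alpha>)"
    by (rule sum.distrib)
  also have "(\<Sum>i<k. (2 * lift_const * e / \<Lambda> ^ (k - i)) powr \<alpha>)
      \<le> (2 * lift_const) powr \<alpha> / (1 - \<Lambda> powr - \<alpha>) * e powr \<alpha>"
    using \<alpha>(1) lift_const_ge \<Lambda> by (intro geometric_powr_sum_le) (auto simp: e_def)
  finally show ?thesis
    using that[OF q(1)] unfolding e_def by simp
qed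

text \<open>
  The quantity \<open>real m powr \<beta> * S q m\<close>, with \<open>2 powr \<beta> = H\<close>, does not increase when the period
  is halved at the price of a factor \<open>H\<close> in the sum \<open>S\<close> of distances. It starts below the
  threshold \<open>s0\<close> by \<open>superpolynomial_periodic_approximation\<close>, so the halving step always applies,
  contradicting the well-foundedness of the natural numbers.
\<close>

theorem periodic_orbit_near_invariant_set:
  assumes K: "compactin mtopology K" "K \<noteq> {}" and inv: "f ` K \<subseteq> K"
    and \<rho>: "0 < \<rho>" and inj: "\<And>a. a \<in> K \<Longrightarrow> inj_on f (mball a \<rho>)"
    and pos: "0 < r" "0 < \<theta>" "0 < \<tau>" and \<alpha>: "0 < \<alpha>" "\<alpha> \<le> 1"
  shows "\<exists>Orb. periodic_orbit f Orb \<and>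
    (\<Sum>x\<in>Orb. point_distance d x K powr \<alpha>) \<le> \<tau> * rt_gap d r \<theta> Orb powr \<alpha>"
proof (cases "\<exists>a\<in>K. \<exists>k\<ge>1. (f ^^ k) a = a")
  case True
  then obtain a k where a: "a \<in> K" "1 \<le> k" "(f ^^ k) a = a" by blast
  define Orb where "Orb = {(f ^^ i) a | i. i < k}"
  have "point_distance d x K = 0" if "x \<in> Orb" for x
  proof -
    have "x \<in> K"
      using that a(1) funpow_in_invariant[OF inv] by (auto simp: Orb_def)
    then show ?thesis
      using point_distance_le[of x K x] point_distance_nonneg[OF K(2)] by (simp add: antisym)
  qed
  then have "(\<Sum>x\<in>Orb. point_distance d x K powr \<alpha>) = 0"
    by (intro sum.neutral) simp
  moreover have "periodic_orbit f Orb"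
    unfolding periodic_orbit_def Orb_def using a by blast
  ultimately show ?thesis
    using pos by (intro exI[of _ Orb]) simp
next
  case aper: False
  show ?thesis
  proof (rule ccontr)
    assume contra: "\<not> ?thesis"
    define D where "D x = point_distance d x K powr \<alpha>" for x
    have D0: "0 \<le> D x" for x by (simp add: D_def)
    define S where "S q m = (\<Sum>i<m. D ((f ^^ i) q))" for q m
    obtain k0 where k0: "\<And>k. k0 \<le> k \<Longrightarrow> lift_const / \<Lambda> ^ k \<le> 1 / 2"
    proof -
      have "\<forall>\<^sub>F k in sequentially. lift_const / \<Lambda> ^ k < 1 / 2"
        by (rule eventually_contracted) simp
      then obtain k0 where "\<And>k. k0 \<le> k \<Longrightarrow> lift_const / \<Lambda> ^ k < 1 / 2"
        unfolding eventually_sequentially by blast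
      then show ?thesis
        using that[of k0] less_imp_le by blast
    qed
    obtain \<eta> where \<eta>: "0 < \<eta>" "\<And>x k. point_distance d x K < \<eta> \<Longrightarrow> 1 \<le> k \<Longrightarrow> k < k0 \<Longrightarrow> \<eta> \<le> d ((f ^^ k) x) x"
      using no_short_returns[OF K, of k0] aper by blast
    define e0 where "e0 = min \<eta> (1 / L)"
    have e0: "0 < e0" using \<eta>(1) L by (simp add: e0_def)
    define B where "B = (2 * lift_const) powr \<alpha> / (1 - \<Lambda> powr - \<alpha>)"
    have B: "0 \<le> B"
      using \<Lambda> \<alpha> powr_less_one[of \<Lambda> "-\<alpha>"] by (simp add: B_def)
    \<comment> \<open>If the inequality fails at level s, then (d x y) powr \<alpha> is below s / (\<tau> * \<theta> powr \<alpha>) for two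
      points of the orbit, and closing up costs at most B times this amount.\<close>
    define H where "H = 1 + B / (\<tau> * \<theta> powr \<alpha>)"
    have H: "1 \<le> H" using B pos by (simp add: H_def)
    \<comment> \<open>The three bounds ensure, in this order, that r is not what makes the gap small, that all points of
      the orbit are near K, and that the return is close enough to be closed up and too close to be a
      short one.\<close>
    define s0 where "s0 = min (\<tau> * r powr \<alpha>) (min (\<eta> powr \<alpha>) (\<tau> * (\<theta> * e0) powr \<alpha>)) / 2"
    have s0: "0 < s0" "s0 < \<tau> * r powr \<alpha>" "s0 < \<eta> powr \<alpha>" "s0 < \<tau> * (\<theta> * e0) powr \<alpha>"
    proof -
      have "0 < min (\<tau> * r powr \<alpha>) (min (\<eta> powr \<alpha>) (\<tau> * (\<theta> * e0) powr \<alpha>))"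
        using pos \<eta>(1) e0 by simp
      then show "0 < s0" "s0 < \<tau> * r powr \<alpha>" "s0 < \<eta> powr \<alpha>" "s0 < \<tau> * (\<theta> * e0) powr \<alpha>"
        unfolding s0_def by linarith+
    qed
    have step: "\<exists>q' k. 1 \<le> k \<and> 2 * k \<le> m \<and> (f ^^ k) q' = q' \<and> S q' k \<le> H * s"
      if m: "1 \<le> m" "(f ^^ m) q = q" and Sm: "S q m \<le> s" and s: "s \<le> s0" for q m s
    proof -
      define Orb where "Orb = {(f ^^ i) q | i. i < m}"
      have Orb_eq: "Orb = (\<lambda>i. (f ^^ i) q) ` {..<m}"
        by (auto simp: Orb_def)
      have "periodic_orbit f Orb"
        unfolding periodic_orbit_def Orb_def using m by blast
      then have "\<tau> * rt_gap d r \<theta> Orb powr \<alpha> < (\<Sum>x\<in>Orb. D x)"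
        using contra unfolding D_def by (meson not_le)
      also have "\<dots> \<le> S q m"
        unfolding S_def Orb_eq using sum_image_le[of "{..<m}" D "\<lambda>i. (f ^^ i) q"] D0
        by (simp add: o_def)
      finally have bad: "\<tau> * rt_gap d r \<theta> Orb powr \<alpha> < s"
        using Sm by simp
      have "finite Orb" by (simp add: Orb_eq)
      then obtain x y where xy: "x \<in> Orb" "y \<in> Orb" "x \<noteq> y" "rt_gap d r \<theta> Orb = \<theta> * d x y"
      proof (rule rt_gap_cases[OF _ pos(2)])
        assume "rt_gap d r \<theta> Orb = r"
        then show ?thesis using bad s s0(2) by simp
      qed blast
      obtain b k where k: "1 \<le> k" "2 * k \<le> m" and ret: "d ((f ^^ k) ((f ^^ b) q)) ((f ^^ b) q) = d x y"
        using periodic_orbit_halving[OF m(2) xy(1,2)[unfolded Orb_def] xy(3), of d] commute by metis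
      define z where "z = (f ^^ b) q"
      define e where "e = d x y"
      have e_powr: "\<tau> * (\<theta> powr \<alpha> * e powr \<alpha>) < s"
        using bad xy(4) pos by (simp add: powr_mult e_def)
      have "e < e0"
      proof (rule ccontr)
        assume "\<not> e < e0"
        then have "(\<theta> * e0) powr \<alpha> \<le> (\<theta> * e) powr \<alpha>"
          using pos e0 \<alpha> by (intro powr_mono2) auto
        then have "\<tau> * (\<theta> * e0) powr \<alpha> \<le> \<tau> * (\<theta> * e) powr \<alpha>"
          using pos by (intro mult_left_mono) auto
        then show False
          using bad xy(4) s s0(4) by (simp add: e_def)
      qed
      have sums: "S z k \<le> s"
        using sum_orbit_segment_le[OF m(2), of k D b] k D0 Sm unfolding S_def z_def by simp
      have "k0 \<le> k"
      proof (rule ccontr)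
        assume "\<not> k0 \<le> k"
        have "D z \<le> S z k"
          unfolding S_def using member_le_sum[of 0 "{..<k}" "\<lambda>i. D ((f ^^ i) z)"] k D0 by simp
        then have "D z < \<eta> powr \<alpha>"
          using sums s s0(3) by simp
        then have "point_distance d z K < \<eta>"
          unfolding D_def using powr_mono2[of \<alpha> \<eta> "point_distance d z K"] \<alpha> \<eta>(1) by force
        then have "\<eta> \<le> e"
          using \<eta>(2)[of z k] k \<open>\<not> k0 \<le> k\<close> ret by (simp add: z_def e_def)
        then show False
          using \<open>e < e0\<close> by (simp add: e0_def)
      qed
      moreover have dz: "d ((f ^^ k) z) z = e"
        using ret by (simp add: z_def e_def)
      moreover have "e < 1 / L"
        using \<open>e < e0\<close> by (simp add: e0_def)
      ultimately obtain q' where q': "(f ^^ k) q' = q'" "S q' k \<le> S z k + B * e powr \<alpha>"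
        using closed_up_orbit_near[OF K(2) \<alpha> k0, of k z] unfolding S_def D_def B_def by metis
      have "e powr \<alpha> \<le> s / (\<tau> * \<theta> powr \<alpha>)"
        using e_powr pos by (simp add: field_simps)
      then have "B * e powr \<alpha> \<le> B * (s / (\<tau> * \<theta> powr \<alpha>))"
        using B by (intro mult_left_mono)
      then have "S q' k \<le> H * s"
        using q'(2) sums by (simp add: H_def algebra_simps)
      then show ?thesis
        using k q'(1) by blast
    qed
    define \<beta> where "\<beta> = log 2 H"
    have \<beta>: "0 \<le> \<beta>" "2 powr \<beta> = H"
      using H by (auto simp: \<beta>_def)
    have descent: False if "1 \<le> m" "(f ^^ m) q = q" "real m powr \<beta> * S q m \<le> s0" for q m
    proof -
      have "\<forall>q s. 1 \<le> m \<longrightarrow> (f ^^ m) q = q \<longrightarrow> S q m \<le> s \<longrightarrow> real m powr \<beta> * s \<le> s0 \<longrightarrow> False" for m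
      proof (induction m rule: less_induct)
        case (less m)
        show ?case
        proof (intro allI impI)
          fix q s
          assume m: "1 \<le> m" "(f ^^ m) q = q" "S q m \<le> s" "real m powr \<beta> * s \<le> s0"
          have "0 \<le> S q m"
            unfolding S_def using D0 by (intro sum_nonneg)
          then have s0': "0 \<le> s" using m(3) by linarith
          have "1 \<le> real m powr \<beta>"
            using m(1) \<beta>(1) by (simp add: ge_one_powr_ge_zero)
          then have "s \<le> s0"
            using m(4) mult_right_mono[of 1 "real m powr \<beta>" s] s0' by simp
          then obtain q' k where k: "1 \<le> k" "2 * k \<le> m" "(f ^^ k) q' = q'" "S q' k \<le> H * s"
            using step m by blast
          have "real k powr \<beta> * (H * s) = (2 * real k) powr \<beta> * s"
            by (simp add: powr_mult \<beta>(2))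
          also have "\<dots> \<le> real m powr \<beta> * s"
            using k(2) \<beta>(1) s0' by (intro mult_right_mono powr_mono2) auto
          finally have "real k powr \<beta> * (H * s) \<le> s0"
            using m(4) by simp
          then show False
            using less[of k] k by auto
        qed
      qed
      then show False using that by blast
    qed
    obtain q m where "1 \<le> m" "(f ^^ m) q = q" "real m powr \<beta> * S q m \<le> s0"
      using superpolynomial_periodic_approximation[OF K(2) inv \<rho> inj \<alpha>(1) \<beta>(1) s0(1)]
      unfolding S_def D_def by blast
    then show False using descent by blast
  qed
qed

end

section \<open>Jordan curves on a topological sphere\<close>

lemma homeomorphism_open_image:
  assumes "homeomorphism S T \<phi> \<psi>" "open T" "open W" "W \<subseteq> S"
  shows "open (\<phi> ` W)"
proof -
  have "openin (top_of_set S) W"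
    using assms(3,4) by (simp add: open_openin_trans open_subset)
  then have "openin (top_of_set T) (\<phi> ` W)"
    using homeomorphism_imp_open_map[OF assms(1)] by blast
  then show ?thesis
    using assms(2) openin_open_trans by blast
qed

context
  assumes sphere: "(euclidean :: 'a::topological_space topology) homeomorphic_space nsphere 2"
begin

lemma homeomorphism_round_sphere:
  obtains h :: "'a \<Rightarrow> complex \<times> real" and g where "homeomorphism UNIV (sphere 0 1) h g"
proof -
  have "pairwise orthogonal (Basis :: (complex \<times> real) set)"
    by (rule orthogonal_Basis)
  then obtain f :: "(nat \<Rightarrow> real) \<Rightarrow> complex \<times> real" and g
    where "homeomorphic_maps (nsphere (3 - 1)) (top_of_set (sphere 0 1 \<inter> span Basis)) f g"
    using homeomorphic_maps_nsphere_euclidean_sphere[of "Basis :: (complex \<times> real) set" 3]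
    by (auto simp: independent_Basis norm_Basis)
  then have "nsphere 2 homeomorphic_space top_of_set (sphere (0 :: complex \<times> real) 1)"
    by (auto simp: homeomorphic_space_def)
  then have "top_of_set (UNIV :: 'a set) homeomorphic_space top_of_set (sphere (0 :: complex \<times> real) 1)"
    using homeomorphic_space_trans[OF sphere] by simp
  then show ?thesis
    using that unfolding homeomorphic_space_iff_homeomorphic homeomorphic_def homeomorphic_space_def
    by (auto simp del: subtopology_UNIV)
qed

lemma sphere_compact: "compact (UNIV :: 'a set)"
proof -
  obtain h :: "'a \<Rightarrow> complex \<times> real" and g where hg: "homeomorphism UNIV (sphere 0 1) h g"
    by (rule homeomorphism_round_sphere)
  then have "UNIV = g ` sphere 0 1" "continuous_on (sphere 0 1) g"
    by (simp_all add: homeomorphism_def)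
  then show ?thesis
    using compact_continuous_image compact_sphere by metis
qed

text \<open>
  The space is a type without a Hausdorff class constraint, so the property is transported from the
  standard sphere.
\<close>

lemma sphere_closed_if_compact:
  assumes "compact (S :: 'a set)"
  shows "closed S"
proof -
  have "Hausdorff_space (nsphere 2)"
    by (simp add: nsphere_def Euclidean_space_def Hausdorff_space_subtopology
        Hausdorff_space_product_topology)
  then have "Hausdorff_space (euclidean :: 'a topology)"
    using homeomorphic_Hausdorff_space[OF sphere] by simp
  then show ?thesis
    using compactin_imp_closedin[of euclidean S] assms by simp
qed

lemma sphere_closed_singleton: "closed {p :: 'a}"
  by (rule sphere_closed_if_compact) simp

lemma punctured_sphere_homeomorphism:
  obtains \<phi> :: "'a \<Rightarrow> complex" and e where "homeomorphism (UNIV - {p}) UNIV \<phi> e"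
proof -
  obtain h :: "'a \<Rightarrow> complex \<times> real" and g where hg: "homeomorphism UNIV (sphere 0 1) h g"
    by (rule homeomorphism_round_sphere)
  define i :: "complex \<times> real" where "i = (0, 1)"
  have "i \<noteq> 0" by (simp add: i_def zero_prod_def)
  have hp: "h p \<in> sphere 0 1"
    using hg by (auto simp: homeomorphism_def)
  have "h ` (UNIV - {p}) = sphere 0 1 - {h p}"
    using hg by (auto simp: homeomorphism_def) (metis UNIV_I)+
  then have "homeomorphism (UNIV - {p}) (sphere 0 1 - {h p}) h g"
    by (intro homeomorphism_of_subsets[OF hg]) auto
  then have "(UNIV - {p}) homeomorphic (sphere 0 1 - {h p})"
    unfolding homeomorphic_def by blast
  also have "(sphere 0 1 - {h p}) homeomorphic {x. i \<bullet> x = 0}"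
    using homeomorphic_punctured_sphere_hyperplane[OF _ hp \<open>i \<noteq> 0\<close>] by simp
  also have "{x. i \<bullet> x = 0} homeomorphic (UNIV :: complex set)"
    using \<open>i \<noteq> 0\<close> by (intro homeomorphic_subspaces) (auto simp: subspace_hyperplane dim_hyperplane)
  finally show ?thesis
    using that unfolding homeomorphic_def by blast
qed

text \<open>
  The complement of any second point will do; here it is a pole other than \<open>x\<close>.
\<close>

lemma planar_neighbourhood:
  obtains U \<phi> e where "open U" "(x :: 'a) \<in> U" "homeomorphism U (UNIV :: complex set) \<phi> e"
proof -
  obtain h :: "'a \<Rightarrow> complex \<times> real" and g where hg: "homeomorphism UNIV (sphere 0 1) h g"
    by (rule homeomorphism_round_sphere)
  define s :: "complex \<times> real" where "s = (if h x = (0, 1) then (0, - 1) else (0, 1))"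
  have "s \<in> sphere 0 1" "s \<noteq> h x"
    by (auto simp: s_def norm_Pair)
  moreover define p where "p = g s"
  ultimately have "p \<noteq> x"
    using homeomorphism_apply2[OF hg] by metis
  moreover have "open (UNIV - {p})"
    using sphere_closed_singleton by (simp add: open_Diff)
  moreover obtain \<phi> :: "'a \<Rightarrow> complex" and e where "homeomorphism (UNIV - {p}) UNIV \<phi> e"
    by (rule punctured_sphere_homeomorphism)
  ultimately show ?thesis
    using that[of "UNIV - {p}" \<phi> e] by blast
qed

lemma sphere_not_open_singleton: "\<not> open {x :: 'a}"
proof
  assume "open {x}"
  obtain U \<phi> and e :: "complex \<Rightarrow> 'a" where U: "open U" "x \<in> U" "homeomorphism U UNIV \<phi> e"
    by (rule planar_neighbourhood)
  have "open (\<phi> ` {x})"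
    by (rule homeomorphism_open_image[OF U(3) open_UNIV \<open>open {x}\<close>]) (use U(2) in simp)
  then show False
    using not_open_singleton[of "\<phi> x"] by simp
qed

lemma sphere_open_component:
  assumes "open (S :: 'a set)" "c \<in> components S"
  shows "open c"
proof (subst open_subopen, intro ballI)
  fix x assume "x \<in> c"
  then have "x \<in> S"
    using assms(2) in_components_subset by blast
  obtain U \<phi> and e :: "complex \<Rightarrow> 'a" where U: "open U" "x \<in> U" "homeomorphism U UNIV \<phi> e"
    by (rule planar_neighbourhood)
  have "open (\<phi> ` (U \<inter> S))"
    by (rule homeomorphism_open_image[OF U(3)]) (use U(1) assms(1) in auto)
  moreover have "\<phi> x \<in> \<phi> ` (U \<inter> S)"
    using U(2) \<open>x \<in> S\<close> by blast
  ultimately obtain \<epsilon> where \<epsilon>: "0 < \<epsilon>" "ball (\<phi> x) \<epsilon> \<subseteq> \<phi> ` (U \<inter> S)"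
    by (rule openE)
  define W where "W = e ` ball (\<phi> x) \<epsilon>"
  have "e y \<in> S" if y: "y \<in> ball (\<phi> x) \<epsilon>" for y
  proof -
    obtain u where "u \<in> U \<inter> S" "y = \<phi> u"
      using \<epsilon>(2) y by blast
    then show ?thesis
      using homeomorphism_apply1[OF U(3), of u] by simp
  qed
  then have "W \<subseteq> S"
    by (auto simp: W_def)
  moreover have "connected W"
    unfolding W_def using U(3)
    by (intro connected_continuous_image connected_ball) (auto simp: homeomorphism_def intro: continuous_on_subset)
  moreover have "x \<in> W"
    unfolding W_def using homeomorphism_apply1[OF U(3,2)] \<epsilon>(1) by (metis centre_in_ball imageI)
  ultimately have "W \<subseteq> c"
    using components_maximal[OF assms(2)] \<open>x \<in> c\<close> by blast
  moreover have "open W"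
    unfolding W_def by (rule homeomorphism_open_image[OF homeomorphism_symD[OF U(3)] U(1)]) auto
  ultimately show "\<exists>T. open T \<and> x \<in> T \<and> T \<subseteq> c"
    using \<open>x \<in> W\<close> by blast
qed

lemma Jordan_curve_closed:
  assumes "Jordan_curve (C :: 'a set)"
  shows "closed C"
proof -
  obtain k where "continuous_on (sphere (0::complex) 1) k" "k ` sphere 0 1 = C"
    using assms unfolding Jordan_curve_def homeomorphic_def homeomorphism_def by blast
  then have "compact C"
    using compact_continuous_image compact_sphere by metis
  then show ?thesis by (rule sphere_closed_if_compact)
qed

text \<open>
  An interior point would give an injective continuous map from an open set of the plane into the unit
  circle; by invariance of domain its image is open, but the circle is negligible.
\<close>

lemma Jordan_curve_interior:
  assumes "Jordan_curve (C :: 'a set)"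
  shows "interior C = {}"
proof (rule ccontr)
  assume "interior C \<noteq> {}"
  then obtain x where x: "x \<in> interior C" by blast
  obtain k k' where k: "homeomorphism C (sphere (0::complex) 1) k k'"
    using assms unfolding Jordan_curve_def homeomorphic_def by blast
  obtain U \<phi> and e :: "complex \<Rightarrow> 'a" where U: "open U" "x \<in> U" "homeomorphism U UNIV \<phi> e"
    by (rule planar_neighbourhood)
  define V where "V = \<phi> ` (U \<inter> interior C)"
  have "open V"
    unfolding V_def by (rule homeomorphism_open_image[OF U(3)]) (use U(1) in auto)
  have eV: "e ` V \<subseteq> C"
    using homeomorphism_apply1[OF U(3)] interior_subset[of C] by (fastforce simp: V_def)
  have "open ((k \<circ> e) ` V)"
  proof (rule invariance_of_domain[OF _ \<open>open V\<close>])
    show "continuous_on V (k \<circ> e)"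
      using U(3) k eV by (intro continuous_on_compose) (auto simp: homeomorphism_def intro: continuous_on_subset)
    have "inj_on e V"
      using homeomorphism_apply2[OF U(3)] by (metis UNIV_I inj_onI)
    moreover have "inj_on k (e ` V)"
      using homeomorphism_apply1[OF k] eV by (metis inj_on_def subsetD)
    ultimately show "inj_on (k \<circ> e) V"
      by (rule comp_inj_on)
  qed
  moreover have "(k \<circ> e) ` V \<subseteq> sphere 0 1"
    using eV k by (auto simp: homeomorphism_def)
  then have "negligible ((k \<circ> e) ` V)"
    using negligible_sphere negligible_subset by blast
  moreover have "\<phi> x \<in> V"
    using x U(2) by (auto simp: V_def)
  ultimately show False
    using open_not_negligible by blast
qed

text \<open>
  Stereographic projection from a point \<open>p\<close> off the curve turns the curve into a simple closed curve in
  the plane, whose complement has two components. Their preimages, together with \<open>p\<close>, fill the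
  complement of the curve.
\<close>

lemma Jordan_curve_finite_components:
  assumes "Jordan_curve (C :: 'a set)"
  shows "finite (components (UNIV - C))"
proof -
  have "C \<noteq> UNIV"
  proof
    assume "C = UNIV"
    then have "interior C = UNIV" by simp
    then show False
      using Jordan_curve_interior[OF assms] by simp
  qed
  then obtain p where p: "p \<notin> C" by blast
  obtain \<phi> :: "'a \<Rightarrow> complex" and e where \<phi>: "homeomorphism (UNIV - {p}) UNIV \<phi> e"
    by (rule punctured_sphere_homeomorphism)
  obtain k k' where k: "homeomorphism (sphere (0::complex) 1) C k k'"
    using assms homeomorphic_sym unfolding Jordan_curve_def homeomorphic_def by metis
  have kC: "k ` sphere 0 1 = C"
    using k by (simp add: homeomorphism_def)
  define c where "c = \<phi> \<circ> k \<circ> circlepath 0 1"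
  have circ: "path_image (circlepath (0::complex) 1) = sphere 0 1"
    by simp
  have cimage: "path_image c = \<phi> ` C"
    by (simp only: c_def path_image_compose circ flip: image_comp kC)
  have "simple_path c"
    unfolding c_def
  proof (rule simple_path_continuous_image)
    show "continuous_on (path_image (circlepath 0 1)) (\<phi> \<circ> k)"
      using k \<phi> p unfolding circ
      by (intro continuous_on_compose) (auto simp: homeomorphism_def intro: continuous_on_subset)
    have "inj_on k (sphere 0 1)"
      using homeomorphism_apply1[OF k] by (metis inj_onI)
    moreover have "inj_on \<phi> C"
      using homeomorphism_apply1[OF \<phi>] p by (metis DiffI UNIV_I inj_onI singletonD)
    ultimately show "inj_on (\<phi> \<circ> k) (path_image (circlepath 0 1))"
      unfolding circ by (intro comp_inj_on) (simp_all add: kC)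
  qed (simp add: simple_path_circlepath)
  moreover have "pathfinish c = pathstart c"
    by (simp add: c_def pathfinish_compose pathstart_compose)
  ultimately obtain inner outer where io: "connected inner" "connected outer"
    "inner \<noteq> {}" "outer \<noteq> {}" "inner \<union> outer = - \<phi> ` C"
    using Jordan_curve[of c] cimage by metis
  have sub: "e ` inner \<subseteq> UNIV - C" "e ` outer \<subseteq> UNIV - C"
    using io(5) homeomorphism_apply2[OF \<phi>] by (force)+
  have conn: "connected (e ` S)" if "connected S" for S
    using that \<phi> by (intro connected_continuous_image) (auto simp: homeomorphism_def intro: continuous_on_subset)
  obtain a b where ab: "a \<in> inner" "b \<in> outer"
    using io by blast
  define comp where "comp = connected_component_set (UNIV - C)"
  have "comp x \<in> comp ` {e a, e b, p}" if "x \<notin> C" for x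
  proof (cases "x = p")
    case False
    then have x: "x = e (\<phi> x)"
      using homeomorphism_apply1[OF \<phi>] by simp
    have "\<phi> x \<notin> \<phi> ` C"
    proof
      assume "\<phi> x \<in> \<phi> ` C"
      then obtain y where "y \<in> C" "\<phi> x = \<phi> y" by blast
      then have "x = y"
        using x homeomorphism_apply1[OF \<phi>, of y] p by auto
      then show False
        using \<open>y \<in> C\<close> that by simp
    qed
    then consider "\<phi> x \<in> inner" | "\<phi> x \<in> outer"
      using io(5) by blast
    then show ?thesis
    proof cases
      case 1
      then have "connected_component (UNIV - C) x (e a)"
        unfolding connected_component_def using sub(1) conn[OF io(1)] ab(1) x
        by (intro exI[of _ "e ` inner"]) auto
      then show ?thesis
        unfolding comp_def by (metis connected_component_eq insertI1 image_eqI mem_Collect_eq)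
    next
      case 2
      then have "connected_component (UNIV - C) x (e b)"
        unfolding connected_component_def using sub(2) conn[OF io(2)] ab(2) x
        by (intro exI[of _ "e ` outer"]) auto
      then show ?thesis
        unfolding comp_def by (metis connected_component_eq insertI1 insertI2 image_eqI mem_Collect_eq)
    qed
  qed simp
  then have "components (UNIV - C) \<subseteq> comp ` {e a, e b, p}"
    unfolding components_def comp_def by blast
  then show ?thesis
    by (rule finite_subset) simp
qed

end

section \<open>Branched covering maps\<close>

lemma planar_chartD:
  assumes "planar_chart U \<phi>"
  shows "open U" "open (\<phi> ` U)" "homeomorphism U (\<phi> ` U) \<phi> (inv_into U \<phi>)" "inj_on \<phi> U"
  using assms homeomorphism_apply1[of U "\<phi> ` U" \<phi> "inv_into U \<phi>"]
  unfolding planar_chart_def by (auto intro: inj_on_inverseI)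

lemma local_power_formE:
  assumes "local_power_form A f x k"
  obtains U V \<phi> \<psi> where "planar_chart U \<phi>" "planar_chart V \<psi>" "x \<in> U" "f ` U \<subseteq> V"
    "\<phi> x = 0" "\<psi> (f x) = 0" "\<And>u. u \<in> U \<Longrightarrow> \<psi> (f u) = \<phi> u ^ k"
  using assms unfolding local_power_form_def oriented_chart_def by blast

lemma open_power_image:
  assumes "open (S :: complex set)" "1 \<le> k"
  shows "open ((\<lambda>z. z ^ k) ` S)"
proof (rule open_mapping_thm[of _ UNIV])
  show "\<not> (\<lambda>z::complex. z ^ k) constant_on UNIV"
  proof
    assume "(\<lambda>z::complex. z ^ k) constant_on UNIV"
    then obtain c where c: "\<And>z::complex. z ^ k = c"
      unfolding constant_on_def by blast
    show False
      using c[of 0] c[of 1] assms(2) by (simp add: power_0_left split: if_splits)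
  qed
qed (use assms(1) in \<open>auto intro!: holomorphic_intros\<close>)

lemma branched_covering_open_map:
  assumes "branched_covering_map A f" "open W"
  shows "open (f ` W)"
proof (subst open_subopen, intro ballI)
  fix y assume "y \<in> f ` W"
  then obtain x where x: "x \<in> W" "y = f x" by blast
  obtain k where k: "1 \<le> k" "local_power_form A f x k"
    using assms(1) unfolding branched_covering_map_def by blast
  obtain U V \<phi> \<psi> where ch: "planar_chart U \<phi>" "planar_chart V \<psi>" "x \<in> U" "f ` U \<subseteq> V"
    "\<And>u. u \<in> U \<Longrightarrow> \<psi> (f u) = \<phi> u ^ k"
    using local_power_formE[OF k(2)] by metis
  note U = planar_chartD[OF ch(1)] and V = planar_chartD[OF ch(2)]
  define W' where "W' = U \<inter> W"
  have "open W'" using U(1) assms(2) by (simp add: W'_def open_Int)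
  have "open (\<phi> ` W')"
    by (rule homeomorphism_open_image[OF U(3,2) \<open>open W'\<close>]) (simp add: W'_def)
  then have "open ((\<lambda>z. z ^ k) ` \<phi> ` W')"
    using open_power_image k(1) by blast
  also have "(\<lambda>z. z ^ k) ` \<phi> ` W' = \<psi> ` f ` W'"
    unfolding image_image using ch(5) by (intro image_cong) (auto simp: W'_def)
  finally have "open (inv_into V \<psi> ` \<psi> ` f ` W')"
    using ch(4) by (intro homeomorphism_open_image[OF homeomorphism_symD[OF V(3)] V(1)]) (auto simp: W'_def)
  moreover have "inv_into V \<psi> ` \<psi> ` f ` W' = f ` W'"
    using V(4) ch(4) by (intro inv_into_image_cancel) (auto simp: W'_def)
  ultimately show "\<exists>T. open T \<and> y \<in> T \<and> T \<subseteq> f ` W"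
    using x ch(3) by (intro exI[of _ "f ` W'"]) (auto simp: W'_def)
qed

lemma branched_covering_discrete_fibre:
  assumes "branched_covering_map A f"
  obtains U where "open U" "x \<in> U" "\<And>u. u \<in> U \<Longrightarrow> f u = f x \<Longrightarrow> u = x"
proof -
  obtain k where k: "1 \<le> k" "local_power_form A f x k"
    using assms unfolding branched_covering_map_def by blast
  obtain U V \<phi> \<psi> where ch: "planar_chart U \<phi>" "x \<in> U" "\<phi> x = 0"
    "\<psi> (f x) = 0" "\<And>u. u \<in> U \<Longrightarrow> \<psi> (f u) = \<phi> u ^ k"
    using local_power_formE[OF k(2)] by metis
  note U = planar_chartD[OF ch(1)]
  have "u = x" if "u \<in> U" "f u = f x" for u
  proof -
    have "\<phi> u ^ k = 0"
      using ch(4,5) that by metis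
    then have "\<phi> u = \<phi> x"
      using k(1) ch(3) by simp
    then show ?thesis
      using inj_onD[OF U(4)] that(1) ch(2) by blast
  qed
  then show ?thesis
    using that[OF U(1) ch(2)] by blast
qed

text \<open>
  In a small round disc, \<open>w \<noteq> 0\<close> has exactly \<open>k\<close> roots of order \<open>k\<close>. This determines \<open>k\<close> by
  the topology of \<open>f\<close> alone.
\<close>

lemma local_power_form_preimage_count:
  assumes "local_power_form A f x k" "1 \<le> k" "open W" "x \<in> W"
  obtains W' N where "W' \<subseteq> W" "open W'" "x \<in> W'" "open N" "f x \<in> N"
    "\<And>y. y \<in> N \<Longrightarrow> y \<noteq> f x \<Longrightarrow> card {u \<in> W'. f u = y} = k"
proof -
  obtain U V \<phi> \<psi> where ch: "planar_chart U \<phi>" "planar_chart V \<psi>" "x \<in> U" "f ` U \<subseteq> V"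
    "\<phi> x = 0" "\<psi> (f x) = 0" "\<And>u. u \<in> U \<Longrightarrow> \<psi> (f u) = \<phi> u ^ k"
    using local_power_formE[OF assms(1)] by metis
  note U = planar_chartD[OF ch(1)] and V = planar_chartD[OF ch(2)]
  have "open (\<phi> ` (U \<inter> W))"
    by (rule homeomorphism_open_image[OF U(3,2)]) (use U(1) assms(3) in auto)
  moreover have "0 \<in> \<phi> ` (U \<inter> W)"
    using ch(3,5) assms(4) by force
  ultimately obtain \<rho> where \<rho>: "0 < \<rho>" "ball 0 \<rho> \<subseteq> \<phi> ` (U \<inter> W)"
    by (rule openE)
  define e where "e = inv_into U \<phi>"
  have e: "e z \<in> U \<inter> W \<and> \<phi> (e z) = z" if "norm z < \<rho>" for z
  proof -
    have "z \<in> ball 0 \<rho>" using that by simp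
    then obtain u where "u \<in> U \<inter> W" "z = \<phi> u"
      using \<rho>(2) by blast
    then show ?thesis
      using U(4) by (simp add: e_def inv_into_f_f)
  qed
  have e\<phi>: "e (\<phi> u) = u" if "u \<in> U" for u
    using that U(4) by (simp add: e_def inv_into_f_f)
  define W' where "W' = e ` ball 0 \<rho>"
  define N where "N = inv_into V \<psi> ` (\<psi> ` V \<inter> ball 0 (\<rho> ^ k))"
  show ?thesis
  proof (rule that[of W' N])
    show "W' \<subseteq> W"
      using e by (auto simp: W'_def)
    show "open W'"
      unfolding W'_def e_def using \<rho>(2)
      by (intro homeomorphism_open_image[OF homeomorphism_symD[OF U(3)] U(1)]) auto
    show "x \<in> W'"
      using e\<phi>[OF ch(3)] ch(5) \<rho>(1) unfolding W'_def by (metis centre_in_ball imageI)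
    show "open N"
      unfolding N_def using V(2)
      by (intro homeomorphism_open_image[OF homeomorphism_symD[OF V(3)] V(1)]) auto
    have fxV: "f x \<in> V" using ch(3,4) by blast
    show "f x \<in> N"
      unfolding N_def
    proof (rule image_eqI)
      show "f x = inv_into V \<psi> (\<psi> (f x))"
        using fxV V(4) by (simp add: inv_into_f_f)
      show "\<psi> (f x) \<in> \<psi> ` V \<inter> ball 0 (\<rho> ^ k)"
        using fxV ch(6) \<rho>(1) by (metis IntI centre_in_ball imageI zero_less_power)
    qed
    fix y assume y: "y \<in> N" "y \<noteq> f x"
    have yV: "y \<in> V" "norm (\<psi> y) < \<rho> ^ k"
      using y(1) V(4) by (auto simp: N_def inv_into_f_f)
    have "\<psi> y \<noteq> 0"
      using inj_onD[OF V(4), of y "f x"] fxV yV(1) y(2) ch(6) by metis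
    have "{u \<in> W'. f u = y} = e ` {z. z ^ k = \<psi> y}"
    proof (intro equalityI subsetI)
      fix u assume "u \<in> {u \<in> W'. f u = y}"
      then obtain z where z: "norm z < \<rho>" "u = e z" "f u = y"
        by (auto simp: W'_def)
      then have "z ^ k = \<psi> y"
        using e[OF z(1)] ch(7)[of u] by simp
      then show "u \<in> e ` {z. z ^ k = \<psi> y}"
        using z(2) by blast
    next
      fix u assume "u \<in> e ` {z. z ^ k = \<psi> y}"
      then obtain z where z: "u = e z" "z ^ k = \<psi> y" by blast
      have "norm z ^ k < \<rho> ^ k"
        using yV(2) z(2) by (metis norm_power)
      then have "norm z < \<rho>"
        using \<rho>(1) by (simp add: power_less_imp_less_base)
      then have u: "u \<in> U" "\<phi> u = z" "u \<in> W'"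
        using e[of z] z(1) by (auto simp: W'_def)
      then have "\<psi> (f u) = \<psi> y"
        using ch(7)[of u] z(2) by simp
      then have "f u = y"
        using inj_onD[OF V(4)] u(1) ch(4) yV(1) by blast
      then show "u \<in> {u \<in> W'. f u = y}"
        using u(3) by blast
    qed
    moreover have "inj_on e {z. z ^ k = \<psi> y}"
    proof (rule inj_on_inverseI)
      fix z assume "z \<in> {z. z ^ k = \<psi> y}"
      then have "norm z ^ k < \<rho> ^ k"
        using yV(2) by (simp flip: norm_power)
      then show "\<phi> (e z) = z"
        using e[of z] \<rho>(1) by (simp add: power_less_imp_less_base)
    qed
    ultimately show "card {u \<in> W'. f u = y} = k"
      using card_nth_roots[OF \<open>\<psi> y \<noteq> 0\<close>, of k] assms(2) by (simp add: card_image)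
  qed
qed

context
  assumes sphere: "(euclidean :: 'a::topological_space topology) homeomorphic_space nsphere 2"
begin

text \<open>
  Both normal forms count the preimages of the same nearby point, one of them in a smaller neighbourhood.
\<close>

lemma local_power_form_le:
  fixes f :: "'a \<Rightarrow> 'a"
  assumes "local_power_form A f x k" "1 \<le> k" and "local_power_form A f x k'" "1 \<le> k'"
  shows "k' \<le> k"
proof -
  obtain W N where W: "open W" "x \<in> W" "open N" "f x \<in> N"
    "\<And>y. y \<in> N \<Longrightarrow> y \<noteq> f x \<Longrightarrow> card {u \<in> W. f u = y} = k"
    using local_power_form_preimage_count[OF assms(1,2) open_UNIV UNIV_I] by metis
  obtain W' N' where W': "W' \<subseteq> W" "open N'" "f x \<in> N'"
    "\<And>y. y \<in> N' \<Longrightarrow> y \<noteq> f x \<Longrightarrow> card {u \<in> W'. f u = y} = k'"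
    using local_power_form_preimage_count[OF assms(3,4) W(1,2)] by metis
  have "open (N \<inter> N')" using W(3) W'(2) by (rule open_Int)
  then have "N \<inter> N' \<noteq> {f x}"
    using sphere_not_open_singleton[OF sphere] by metis
  then obtain y where y: "y \<in> N" "y \<in> N'" "y \<noteq> f x"
    using W(4) W'(3) by blast
  have "card {u \<in> W. f u = y} = k"
    using W(5) y by blast
  then have "finite {u \<in> W. f u = y}"
    using assms(2) by (intro card_ge_0_finite) simp
  then have "card {u \<in> W'. f u = y} \<le> card {u \<in> W. f u = y}"
    using W'(1) by (intro card_mono) auto
  then show ?thesis
    using W(5)[OF y(1,3)] W'(4)[OF y(2,3)] by simp
qed

text \<open>
  By \<open>local_power_form_le\<close> the local degree is the exponent of any normal form, and exponent \<open>1\<close>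
  makes \<open>f\<close> injective on the chart domain.
\<close>

lemma locally_injective_off_crit:
  fixes f :: "'a \<Rightarrow> 'a"
  assumes "branched_covering_map A f" "x \<notin> crit A f"
  obtains U where "open U" "x \<in> U" "inj_on f U"
proof -
  obtain k where k: "1 \<le> k" "local_power_form A f x k"
    using assms(1) unfolding branched_covering_map_def by blast
  have "local_degree A f x = k"
    unfolding local_degree_def using k local_power_form_le by (intro the_equality) (auto intro: antisym)
  then have "k = 1"
    using assms(2) k(1) by (simp add: crit_def)
  then obtain U V \<phi> \<psi> where ch: "planar_chart U \<phi>" "x \<in> U" "\<And>u. u \<in> U \<Longrightarrow> \<psi> (f u) = \<phi> u ^ 1"
    using local_power_formE[OF k(2)] by metis
  note U = planar_chartD[OF ch(1)]
  have "inj_on f U"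
    using U(4) ch(3) unfolding inj_on_def by (metis power_one_right)
  then show ?thesis
    using that U(1) ch(2) by blast
qed

text \<open>
  Fibres are discrete and compact.
\<close>

lemma branched_covering_finite_fibre:
  fixes f :: "'a \<Rightarrow> 'a"
  assumes "branched_covering_map A f"
  shows "finite (f -` {y})"
proof -
  have "continuous_on UNIV f"
    using assms by (simp add: branched_covering_map_def)
  then have "closed (f -` {y})"
    using sphere_closed_singleton[OF sphere] by (simp add: closed_vimage)
  then have cpt: "compact (f -` {y})"
    using compact_Int_closed[OF sphere_compact[OF sphere]] by simp
  have "\<forall>x. \<exists>U. open U \<and> x \<in> U \<and> (\<forall>u\<in>U. f u = f x \<longrightarrow> u = x)"
    using branched_covering_discrete_fibre[OF assms] by metis
  then obtain U where U: "\<And>x. open (U x)" "\<And>x. x \<in> U x" "\<And>x u. u \<in> U x \<Longrightarrow> f u = f x \<Longrightarrow> u = x"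
    by metis
  have "f -` {y} \<subseteq> (\<Union>x\<in>f -` {y}. U x)"
    using U(2) by blast
  then obtain F where F: "F \<subseteq> f -` {y}" "finite F" "f -` {y} \<subseteq> (\<Union>x\<in>F. U x)"
    by (rule compactE_image[OF cpt U(1)])
  have "f -` {y} \<subseteq> F"
  proof
    fix u assume u: "u \<in> f -` {y}"
    then obtain x where "x \<in> F" "u \<in> U x" using F(3) by blast
    moreover have "f u = f x" using u F(1) \<open>x \<in> F\<close> by auto
    ultimately show "u \<in> F" using U(3) by metis
  qed
  then show ?thesis
    using F(2) finite_subset by blast
qed

end

section \<open>Tiles of a branched covering map\<close>

lemma closure_finite_Union: "finite F \<Longrightarrow> closure (\<Union>F) = \<Union>(closure ` F)"
  by (induction F rule: finite_induct) (auto simp: closure_Un)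

context
  fixes f :: "'a::topological_space \<Rightarrow> 'a"
  assumes sphere: "(euclidean :: 'a topology) homeomorphic_space nsphere 2"
    and cont: "continuous_on UNIV f"
    and open_map: "\<And>W. open W \<Longrightarrow> open (f ` W)"
    and finite_fibre: "\<And>y. finite (f -` {y})"
begin

text \<open>
  The image of \<open>U\<close> is open because \<open>f\<close> is open. It is also relatively closed in the component
  \<open>V\<close> containing it, because boundary points of \<open>U\<close> are mapped into \<open>D\<close>.
\<close>

lemma image_of_preimage_component:
  assumes "closed D" "U \<in> components (UNIV - f -` D)"
  shows "f ` U \<in> components (UNIV - D)"
proof -
  have opn: "open (UNIV - f -` D)"
    using closed_vimage[OF assms(1) cont] by (simp add: open_Diff)
  have U: "U \<noteq> {}" "U \<subseteq> UNIV - f -` D" "connected U"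
    using assms(2) in_components_nonempty in_components_subset in_components_connected by blast+
  have "open U"
    using sphere_open_component[OF sphere opn assms(2)] .
  have conn: "connected (f ` U)"
    using U(3) cont by (metis connected_continuous_image continuous_on_subset subset_UNIV)
  have sub: "f ` U \<subseteq> UNIV - D"
    using U(2) by blast
  obtain V where V: "V \<in> components (UNIV - D)" "f ` U \<subseteq> V"
    using exists_component_superset[OF sub _ conn] U(1) sub by blast
  have "compact (closure U)"
    using compact_Int_closed[OF sphere_compact[OF sphere], of "closure U"] by simp
  then have "compact (f ` closure U)"
    using cont compact_continuous_image continuous_on_subset by blast
  then have cl: "closed (f ` closure U)"
    by (rule sphere_closed_if_compact[OF sphere])
  have boundary: "f ` closure U \<inter> V \<subseteq> f ` U"
  proof
    fix y assume "y \<in> f ` closure U \<inter> V"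
    then obtain x where x: "x \<in> closure U" "y = f x" "y \<in> V" by blast
    then have "x \<in> UNIV - f -` D"
      using in_components_subset[OF V(1)] by auto
    then obtain U' where U': "U' \<in> components (UNIV - f -` D)" "x \<in> U'"
      using Union_components[of "UNIV - f -` D"] by blast
    have "open U'"
      using sphere_open_component[OF sphere opn U'(1)] .
    then have "U' \<inter> U \<noteq> {}"
      using x(1) U'(2) open_Int_closure_eq_empty by blast
    then have "U' = U"
      using components_eq[OF U'(1) assms(2)] by blast
    then show "y \<in> f ` U"
      using U'(2) x(2) by blast
  qed
  have "V \<subseteq> f ` U"
  proof (rule ccontr)
    assume "\<not> V \<subseteq> f ` U"
    have "V \<inter> (- f ` closure U) = {} \<or> V \<inter> f ` U = {}"
    proof (rule connectedD[of V "- f ` closure U" "f ` U", THEN disjE])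
      show "connected V" using in_components_connected[OF V(1)] .
      show "open (- f ` closure U)" using cl by blast
      show "open (f ` U)" using open_map \<open>open U\<close> by blast
      show "- f ` closure U \<inter> f ` U \<inter> V = {}" using closure_subset by blast
      show "V \<subseteq> - f ` closure U \<union> f ` U" using boundary by blast
    qed blast+
    then show False
      using boundary \<open>\<not> V \<subseteq> f ` U\<close> V(2) U(1) by blast
  qed
  then show ?thesis
    using V by (metis antisym)
qed

lemma image_closure_eq: "f ` closure U = closure (f ` U)"
proof
  show "f ` closure U \<subseteq> closure (f ` U)"
    using cont by (intro image_closure_subset) (auto intro: continuous_on_subset closure_subset[THEN subsetD])
  have "compact (closure U)"
    using compact_Int_closed[OF sphere_compact[OF sphere], of "closure U"] by simp
  then have "compact (f ` closure U)"
    using cont compact_continuous_image continuous_on_subset by blast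
  then have "closed (f ` closure U)"
    by (rule sphere_closed_if_compact[OF sphere])
  then show "closure (f ` U) \<subseteq> f ` closure U"
    using closure_subset by (intro closure_minimal) auto
qed

context
  fixes C :: "'a set"
  assumes Jordan: "Jordan_curve C"
begin

lemma continuous_on_iterate: "continuous_on UNIV (f ^^ n)"
proof (induction n)
  case (Suc n)
  then show ?case
    unfolding funpow.simps(2) using cont by (intro continuous_on_compose) (auto intro: continuous_on_subset)
qed (simp add: id_def)

lemma vimage_iterate_Suc: "(f ^^ Suc n) -` C = f -` (f ^^ n) -` C"
  by (simp add: funpow_Suc_right vimage_comp del: funpow.simps)

lemma closed_curve_preimage: "closed ((f ^^ n) -` C)"
  using closed_vimage[OF Jordan_curve_closed[OF sphere Jordan] continuous_on_iterate] .

lemma image_component: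
  "U \<in> components (UNIV - (f ^^ Suc n) -` C) \<Longrightarrow> f ` U \<in> components (UNIV - (f ^^ n) -` C)"
  using image_of_preimage_component[OF closed_curve_preimage, of U n] unfolding vimage_iterate_Suc .

text \<open>
  A component at level \<open>n + 1\<close> is mapped onto a component at level \<open>n\<close> and thus contains a
  point of the finite fibre over a chosen point of that component.
\<close>

lemma finite_curve_components: "finite (components (UNIV - (f ^^ n) -` C))"
proof (induction n)
  case 0
  then show ?case
    using Jordan_curve_finite_components[OF sphere Jordan] by simp
next
  case (Suc n)
  define S where "S = UNIV - (f ^^ Suc n) -` C"
  \<comment> \<open>Every component at the next level over V contains a preimage of this base point of V.\<close>
  define q where "q V = (SOME y. y \<in> V)" for V :: "'a set"
  define F where "F = (\<Union>V\<in>components (UNIV - (f ^^ n) -` C). f -` {q V})"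
  have "finite F"
    unfolding F_def using Suc finite_fibre by blast
  have "U \<in> connected_component_set S ` F" if U: "U \<in> components S" for U
  proof -
    have fU: "f ` U \<in> components (UNIV - (f ^^ n) -` C)"
      using image_component U unfolding S_def by blast
    then have "q (f ` U) \<in> f ` U"
      unfolding q_def using in_components_nonempty some_in_eq by blast
    then obtain x where x: "x \<in> U" "f x = q (f ` U)" by force
    then have "x \<in> F"
      unfolding F_def using fU by blast
    moreover have "U = connected_component_set S x"
      using U x(1) by (metis components_iff connected_component_eq)
    ultimately show ?thesis by blast
  qed
  then have "components S \<subseteq> connected_component_set S ` F" by blast
  then show ?case
    using \<open>finite F\<close> finite_subset unfolding S_def by blast
qed

lemma finite_tiles: "finite (tiles f C n)"
  unfolding tiles_def using finite_curve_components by blast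

lemma interior_curve_preimage: "interior ((f ^^ n) -` C) = {}"
proof (induction n)
  case 0
  then show ?case
    using Jordan_curve_interior[OF sphere Jordan] by simp
next
  case (Suc n)
  have "f ` interior ((f ^^ Suc n) -` C) \<subseteq> interior ((f ^^ n) -` C)"
    using interior_subset[of "(f ^^ Suc n) -` C"] open_map unfolding vimage_iterate_Suc
    by (intro interior_maximal) auto
  then show ?case using Suc by blast
qed

lemma tiles_cover: "\<exists>X\<in>tiles f C n. x \<in> X"
proof -
  have "UNIV = closure (UNIV - (f ^^ n) -` C)"
    using interior_curve_preimage[of n] by (simp add: Compl_eq_Diff_UNIV[symmetric] closure_complement)
  also have "\<dots> = closure (\<Union>(components (UNIV - (f ^^ n) -` C)))"
    by simp
  also have "\<dots> = \<Union>(tiles f C n)"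
    unfolding tiles_def using closure_finite_Union[OF finite_curve_components] .
  finally show ?thesis by blast
qed

lemma tiles_image:
  assumes "X \<in> tiles f C (Suc n)"
  shows "f ` X \<in> tiles f C n"
proof -
  obtain U where U: "U \<in> components (UNIV - (f ^^ Suc n) -` C)" "X = closure U"
    using assms unfolding tiles_def by blast
  then show ?thesis
    using image_component[OF U(1)] unfolding tiles_def U(2) image_closure_eq by blast
qed

text \<open>
  Arbitrarily near \<open>z\<close> there are points that \<open>f\<close> sends into the component \<open>V\<close> with closure \<open>X\<close>. They lie
  in components that are mapped onto \<open>V\<close>, and since these are finite in number, the closure of one of
  them contains \<open>z\<close>.
\<close>

lemma tiles_lift:
  assumes "X \<in> tiles f C n" "f z \<in> X"
  shows "\<exists>Y\<in>tiles f C (Suc n). z \<in> Y \<and> f ` Y = X"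
proof -
  obtain V where V: "V \<in> components (UNIV - (f ^^ n) -` C)" "X = closure V"
    using assms(1) unfolding tiles_def by blast
  define \<U> where "\<U> = {U \<in> components (UNIV - (f ^^ Suc n) -` C). f ` U = V}"
  have fin: "finite \<U>"
    unfolding \<U>_def by (rule finite_subset[OF _ finite_curve_components[of "Suc n"]]) blast
  have "z \<in> closure (\<Union>\<U>)"
    unfolding closure_iff_nhds_not_empty
  proof (intro allI impI)
    fix B S assume BS: "S \<subseteq> B" "open S" "z \<in> S"
    then have "open (f ` S)" "f z \<in> f ` S"
      using open_map by auto
    then have "f ` S \<inter> V \<noteq> {}"
      using assms(2) open_Int_closure_eq_empty unfolding V(2) by blast
    then obtain w where w: "w \<in> S" "f w \<in> V" by blast
    then have "w \<in> UNIV - (f ^^ Suc n) -` C"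
      using in_components_subset[OF V(1)] unfolding vimage_iterate_Suc by auto
    then obtain U where U: "U \<in> components (UNIV - (f ^^ Suc n) -` C)" "w \<in> U"
      using Union_components by blast
    then have "f ` U = V"
      using components_eq[OF image_component[OF U(1)] V(1)] w(2) by blast
    then show "\<Union>\<U> \<inter> B \<noteq> {}"
      using U w(1) BS(1) unfolding \<U>_def by blast
  qed
  then obtain U where U: "U \<in> \<U>" "z \<in> closure U"
    using closure_finite_Union[OF fin] by auto
  then have "closure U \<in> tiles f C (Suc n)" "f ` closure U = X"
    unfolding tiles_def \<U>_def V(2) image_closure_eq by auto
  then show ?thesis
    using U(2) by blast
qed

text \<open>
  The tiles of level \<open>n\<close> that avoid \<open>x\<close> form a finite union of closed sets, and outside it \<open>d x\<close> is at most
  \<open>L / \<Lambda> ^ n\<close>; so the metric topology is coarser than the topology of the sphere. A coarser Hausdorff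
  topology on a compact space is the same topology.
\<close>

lemma mtopology_of_small_tiles:
  assumes "Metric_space UNIV d" "1 < \<Lambda>"
    and diameter: "\<And>n X x y. X \<in> tiles f C n \<Longrightarrow> x \<in> X \<Longrightarrow> y \<in> X \<Longrightarrow> d x y \<le> L / \<Lambda> ^ n"
  shows "Metric_space.mtopology UNIV d = (euclidean :: 'a topology)"
proof -
  interpret Metric_space UNIV d by fact
  have coarser: "open W" if W: "openin mtopology W" for W
  proof (subst open_subopen, intro ballI)
    fix x assume "x \<in> W"
    then obtain e where e: "0 < e" "mball x e \<subseteq> W"
      using W unfolding openin_mtopology by blast
    have "(\<lambda>n. L / \<Lambda> ^ n) \<longlonglongrightarrow> 0"
      using LIMSEQ_divide_realpow_zero[OF assms(2)] .
    then have "\<forall>\<^sub>F n in sequentially. L / \<Lambda> ^ n < e"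
      using order_tendstoD(2) e(1) by blast
    then obtain n where n: "L / \<Lambda> ^ n < e"
      using eventually_happens' sequentially_bot by blast
    define N where "N = - \<Union>{X \<in> tiles f C n. x \<notin> X}"
    have "closed (\<Union>{X \<in> tiles f C n. x \<notin> X})"
      using finite_tiles[of n] by (intro closed_Union) (auto simp: tiles_def)
    then have "open N"
      by (simp add: N_def open_Compl)
    moreover have "N \<subseteq> W"
    proof
      fix y assume "y \<in> N"
      obtain X where X: "X \<in> tiles f C n" "y \<in> X"
        using tiles_cover by blast
      then have "x \<in> X"
        using \<open>y \<in> N\<close> unfolding N_def by blast
      then have "d x y < e"
        using diameter[OF X(1) _ X(2)] n by fastforce
      then show "y \<in> W"
        using e(2) by auto
    qed
    moreover have "x \<in> N"
      by (simp add: N_def)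
    ultimately show "\<exists>T. open T \<and> x \<in> T \<and> T \<subseteq> W"
      by blast
  qed
  have finer: "openin mtopology W" if "open W" for W
  proof -
    have "closed (- W)"
      using that by (simp add: closed_def)
    then have cpt: "compact (- W)"
      using compact_Int_closed[OF sphere_compact[OF sphere], of "- W"] by simp
    have "compactin mtopology (- W)"
      unfolding compactin_def
    proof (intro conjI allI impI)
      fix \<C> assume \<C>: "(\<forall>U\<in>\<C>. openin mtopology U) \<and> - W \<subseteq> \<Union>\<C>"
      then have "\<forall>U\<in>\<C>. open U" "- W \<subseteq> \<Union>\<C>"
        using coarser by blast+
      then show "\<exists>\<F>. finite \<F> \<and> \<F> \<subseteq> \<C> \<and> - W \<subseteq> \<Union>\<F>"
        using cpt unfolding compact_eq_Heine_Borel by metis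
    qed simp
    then have "closedin mtopology (- W)"
      using compactin_imp_closedin[OF Hausdorff_space_mtopology] by blast
    then show ?thesis
      by (simp add: closedin_def Compl_eq_Diff_UNIV double_diff)
  qed
  show ?thesis
    using coarser finer unfolding topology_eq by (auto simp: open_openin[symmetric])
qed

end

end

section \<open>Periodic orbits of expanding Thurston maps\<close>

lemma visual_metricE:
  assumes "visual_metric A f d \<Lambda>"
  obtains C L where "Metric_space UNIV d" "1 < \<Lambda>" "Jordan_curve C" "1 \<le> L"
    "\<And>n X Y x y. X \<in> tiles f C n \<Longrightarrow> Y \<in> tiles f C n \<Longrightarrow> X \<inter> Y = {} \<Longrightarrow> x \<in> X \<Longrightarrow> y \<in> Y
      \<Longrightarrow> 1 / (L * \<Lambda> ^ n) \<le> d x y"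
    "\<And>n X x y. X \<in> tiles f C n \<Longrightarrow> x \<in> X \<Longrightarrow> y \<in> X \<Longrightarrow> d x y \<le> L / \<Lambda> ^ n"
proof -
  obtain C L where C: "Jordan_curve C" "1 \<le> L"
    and estimates: "\<forall>n. (\<forall>\<sigma>\<in>cells A f C n. \<forall>\<tau>\<in>cells A f C n.
        \<sigma> \<inter> \<tau> = {} \<longrightarrow> ereal (1 / (L * \<Lambda> ^ n)) \<le> set_distance d \<sigma> \<tau>) \<and>
      (\<forall>\<tau>\<in>edges A f C n \<union> tiles f C n.
        ereal (1 / (L * \<Lambda> ^ n)) \<le> diam d \<tau> \<and> diam d \<tau> \<le> ereal (L / \<Lambda> ^ n))"
    using assms unfolding visual_metric_def by (elim conjE exE) (rule that)
  have sep: "ereal (1 / (L * \<Lambda> ^ n)) \<le> set_distance d X Y"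
    if "X \<in> cells A f C n" "Y \<in> cells A f C n" "X \<inter> Y = {}" for n X Y
    using spec[OF estimates, of n] that by blast
  have dia: "diam d X \<le> ereal (L / \<Lambda> ^ n)" if "X \<in> edges A f C n \<union> tiles f C n" for n X
    using spec[OF estimates, of n] that by blast
  show ?thesis
  proof (rule that[of C L])
    show "Metric_space UNIV d" "1 < \<Lambda>"
      using assms by (auto simp: visual_metric_def)
    show "1 / (L * \<Lambda> ^ n) \<le> d x y"
      if "X \<in> tiles f C n" "Y \<in> tiles f C n" "X \<inter> Y = {}" "x \<in> X" "y \<in> Y" for n X Y x y
    proof -
      have "set_distance d X Y \<le> ereal (d x y)"
        unfolding set_distance_def using that(4,5) by (intro INF_lower2[of "(x, y)"]) auto
      moreover have "ereal (1 / (L * \<Lambda> ^ n)) \<le> set_distance d X Y"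
        using that(1-3) by (intro sep) (auto simp: cells_def)
      ultimately show ?thesis
        by (metis ereal_less_eq(3) order.trans)
    qed
    show "d x y \<le> L / \<Lambda> ^ n" if "X \<in> tiles f C n" "x \<in> X" "y \<in> X" for n X x y
    proof -
      have "ereal (d x y) \<le> diam d X"
        unfolding diam_def using that(2,3) by (intro SUP_upper2[of "(x, y)"]) auto
      moreover have "diam d X \<le> ereal (L / \<Lambda> ^ n)"
        using that(1) by (intro dia) auto
      ultimately show ?thesis
        by (metis ereal_less_eq(3) order.trans)
    qed
  qed (use C in auto)
qed

theorem lemma8p1:
  fixes A :: "('a::topological_space set \<times> ('a \<Rightarrow> complex)) set"
    and f :: "'a \<Rightarrow> 'a" and C K :: "'a set" and d :: "'a \<Rightarrow> 'a \<Rightarrow> real"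
    and n\<^sub>C :: nat and \<Lambda> r \<theta> \<alpha> \<tau> :: real
  assumes "oriented_sphere A"
    and "Thurston_map A f" and "expanding A f"
    and "Jordan_curve C" and "post A f \<subseteq> C"
    and "1 \<le> n\<^sub>C" and "(f ^^ n\<^sub>C) ` C \<subseteq> C"
    and "visual_metric A f d \<Lambda>"
    and "compact K" and "K \<noteq> {}" and "f ` K \<subseteq> K" and "K \<inter> crit A f = {}"
    and "0 < r" and "0 < \<theta>" and "0 < \<alpha>" and "\<alpha> \<le> 1" and "0 < \<tau>"
  shows "\<exists>Orb. periodic_orbit f Orb \<and>
    (\<Sum>x\<in>Orb. point_distance d x K powr \<alpha>) \<le> \<tau> * rt_gap d r \<theta> Orb powr \<alpha>"
proof -
  have sphere: "(euclidean :: 'a topology) homeomorphic_space nsphere 2"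
    using assms(1) by (simp add: oriented_sphere_def)
  have branched: "branched_covering_map A f"
    using assms(2) by (simp add: Thurston_map_def)
  have cont: "continuous_on UNIV f"
    using branched by (simp add: branched_covering_map_def)
  note opn = branched_covering_open_map[OF branched]
  note fibre = branched_covering_finite_fibre[OF sphere branched]
  obtain C' L where metric: "Metric_space UNIV d" and \<Lambda>: "1 < \<Lambda>"
    and C': "Jordan_curve C'" and L: "1 \<le> L"
    and separation: "\<And>n X Y x y. X \<in> tiles f C' n \<Longrightarrow> Y \<in> tiles f C' n \<Longrightarrow> X \<inter> Y = {}
      \<Longrightarrow> x \<in> X \<Longrightarrow> y \<in> Y \<Longrightarrow> 1 / (L * \<Lambda> ^ n) \<le> d x y"
    and diameter: "\<And>n X x y. X \<in> tiles f C' n \<Longrightarrow> x \<in> X \<Longrightarrow> y \<in> X \<Longrightarrow> d x y \<le> L / \<Lambda> ^ n"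
    using visual_metricE[OF assms(8)] by blast
  have topology: "Metric_space.mtopology UNIV d = (euclidean :: 'a topology)"
    using mtopology_of_small_tiles[OF sphere cont opn fibre C' metric \<Lambda> diameter] .
  interpret visual_tiling d f "tiles f C'" L \<Lambda>
  proof (intro visual_tiling.intro visual_tiling_axioms.intro)
    show "compact_space (Metric_space.mtopology UNIV d)"
      unfolding topology using sphere_compact[OF sphere] by (simp add: compact_space_def)
    show "continuous_map (Metric_space.mtopology UNIV d) (Metric_space.mtopology UNIV d) f"
      unfolding topology using cont by simp
    show "\<exists>X\<in>tiles f C' n. x \<in> X" for n x
      using tiles_cover[OF sphere cont opn fibre C'] .
    show "f ` X \<in> tiles f C' n" if "X \<in> tiles f C' (Suc n)" for X n
      using tiles_image[OF sphere cont opn fibre C' that] .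
    show "\<exists>Y\<in>tiles f C' (Suc n). z \<in> Y \<and> f ` Y = X" if "X \<in> tiles f C' n" "f z \<in> X" for X n z
      using tiles_lift[OF sphere cont opn fibre C' that] .
  qed (fact metric \<Lambda> L separation diameter)+
  have K: "compactin mtopology K"
    unfolding topology using assms(9) by simp
  have "K \<subseteq> \<Union>{U. open U \<and> inj_on f U}"
  proof
    fix x assume "x \<in> K"
    then have "x \<notin> crit A f"
      using assms(12) by blast
    then obtain U where "open U" "x \<in> U" "inj_on f U"
      by (rule locally_injective_off_crit[OF sphere branched])
    then show "x \<in> \<Union>{U. open U \<and> inj_on f U}" by blast
  qed
  then obtain \<rho> where \<rho>: "0 < \<rho>" "\<forall>x\<in>K. \<exists>U\<in>{U. open U \<and> inj_on f U}. mball x \<rho> \<subseteq> U"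
    using lebesgue_number[OF K, of "{U. open U \<and> inj_on f U}"] unfolding topology by auto
  have inj: "inj_on f (mball a \<rho>)" if "a \<in> K" for a
    using \<rho>(2) that inj_on_subset by blast
  show ?thesis
    using periodic_orbit_near_invariant_set[OF K assms(10,11) \<rho>(1) inj assms(13,14,17,15,16)] .
qed

end
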